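(* Let $f:\mathbb{E}\to\mathbb{R}$ be twice differentiable, $\mu$-strongly convex, with $L$-Lipschitz gradient and $L_2$-Lipschitz Hessian (see context), with minimizer $x_*$ and $f_*=f(x_* )$. Let $H:=\sqrt2\,L_2/\mu^{3/2}$. Let $\eta_1\in(0,\tfrac12)$ and let $(x_k)_{k\ge0}$ be generated by the BFGS method (see context) from $x_0\in\mathbb{E}$ and a positive definite $H_0$, with step sizes $h_k=2^{-i_k}$, where $i_k$ is the smallest integer $i\ge0$ such that $f(x_k)-f(x_k-2^{-i}d_k)\ge\eta_12^{-i}\langle\nabla f(x_k),d_k\rangle$. Put $\sigma_k:=\sqrt{f(x_k)-f_*}$, $r_k:=\langle\nabla^2f(x_* )(x_k-x_* ),x_k-x_*\rangle^{1/2}$. Let $S$ be a real number such that $H\sum_{i=0}^{k-1}\sigma_i\le S$ for all $k\ge1$, and let $\Omega:=\psi(\nabla^2f(x_* ),H_0^{-1})+2S$. Let $K_0^L\ge0$ be an integer such that $H\sigma_{K_0^L}\le0.06\,(1-2\eta_1)$. Let $\bar t:=0.9\,\frac{1-2\eta_1}{2(1-\eta_1)}$, $\Upsilon:=[\omega_*(\bar t)]^{-1}$ and $$K_1^L:=\lceil7(\Upsilon+3.02)\,\Omega\rceil.$$ Then, for all $k\ge K_1^L$, $$r_{K_0^L+k}\le2^{-k}\,r_{K_0^L}.$$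
   Context: $\mathbb{E}$ is a real vector space of finite dimension $n\ge1$, $\mathbb{E}^*$ its dual, $\langle s,x\rangle$ the value of $s\in\mathbb{E}^*$ at $x\in\mathbb{E}$. $B:\mathbb{E}\to\mathbb{E}^*$ is a fixed self-adjoint positive definite operator; $\|u\|=\langle Bu,u\rangle^{1/2}$, $\|s\|_*=\langle s,B^{-1}s\rangle^{1/2}$; operators $\mathbb{E}\to\mathbb{E}^*$ carry the induced operator norm. With $\mu,L>0$, $L_2\ge0$, the assumptions on $f$ are, for all $x,y$: $\langle\nabla f(x)-\nabla f(y),x-y\rangle\ge\mu\|x-y\|^2$, $\|\nabla f(x)-\nabla f(y)\|_*\le L\|x-y\|$, $\|\nabla^2f(x)-\nabla^2f(y)\|\le L_2\|x-y\|$. For self-adjoint positive definite $X,Y:\mathbb{E}\to\mathbb{E}^*$, $\psi(X,Y):=\operatorname{Tr}(X^{-1}(Y-X))-\ln\det(X^{-1}Y)\ (\ge0)$. $\omega_*(\tau)=-\tau-\ln(1-\tau)$ for $\tau\in[0,1)$. BFGS method: given $x_0$ and self-adjoint positive definite $H_0:\mathbb{E}^*\to\mathbb{E}$, for $k\ge0$: $d_k=H_k\nabla f(x_k)$; choose a step size $h_k>0$; $x_{k+1}=x_k-h_kd_k$; $\delta_k=x_{k+1}-x_k$, $\gamma_k=\nabla f(x_{k+1})-\nabla f(x_k)$; $$H_{k+1}=H_k-\frac{H_k\gamma_k\delta_k^*+\delta_k\gamma_k^*H_k}{\langle\gamma_k,\delta_k\rangle}+\Bigl(\frac{\langle\gamma_k,H_k\gamma_k\rangle}{\langle\gamma_k,\delta_k\rangle}+1\Bigr)\frac{\delta_k\delta_k^*}{\langle\gamma_k,\delta_k\rangle},$$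 where, e.g., $(\delta\delta^* )s=\langle s,\delta\rangle\delta$ and $(H\gamma\delta^* )s=\langle s,\delta\rangle H\gamma$. Equivalently, $G_k:=H_k^{-1}$ satisfies $G_{k+1}=G_k-\frac{G_k\delta_k\delta_k^*G_k}{\langle G_k\delta_k,\delta_k\rangle}+\frac{\gamma_k\gamma_k^*}{\langle\gamma_k,\delta_k\rangle}$. Standing assumption: $\langle\gamma_k,\delta_k\rangle>0$ for all $k\ge0$ (otherwise the method has already found the minimizer). All $H_k$ are then positive definite. (The scalar constant $H$ is unrelated to the operators $H_k$.) *)

theory Defs
  imports "HOL-Analysis.Analysis"
begin

text \<open>
  The space \<open>E\<close> is an arbitrary type of class \<open>euclidean_space\<close>. Its built-in inner product only
  supplies the topology, for which all norms are equivalent, and the basis used to write down traces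
  and determinants; it is unrelated to the operator \<open>B\<close>. In particular \<open>E\<close> is not identified with
  its dual. Operators are plain functions; in finite dimension linearity entails continuity.
\<close>

type_synonym 'a dual = "'a \<Rightarrow>\<^sub>L real"

abbreviation pairing :: "'a::real_normed_vector dual \<Rightarrow> 'a \<Rightarrow> real"  ("\<langle>_, _\<rangle>")
  where "\<langle>s, x\<rangle> \<equiv> blinfun_apply s x"

definition spd_op :: "('a::euclidean_space \<Rightarrow> 'a dual) \<Rightarrow> bool" where
  "spd_op X \<longleftrightarrow> linear X \<and> (\<forall>u v. \<langle>X u, v\<rangle> = \<langle>X v, u\<rangle>) \<and> (\<forall>u. u \<noteq> 0 \<longrightarrow> \<langle>X u, u\<rangle> > 0)"

definition spd_dual_op :: "('a::euclidean_space dual \<Rightarrow> 'a) \<Rightarrow> bool" where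
  "spd_dual_op H \<longleftrightarrow> linear H \<and> (\<forall>s t. \<langle>s, H t\<rangle> = \<langle>t, H s\<rangle>) \<and> (\<forall>s. s \<noteq> 0 \<longrightarrow> \<langle>s, H s\<rangle> > 0)"

definition primal_norm :: "('a::euclidean_space \<Rightarrow> 'a dual) \<Rightarrow> 'a \<Rightarrow> real" where
  "primal_norm B u = sqrt \<langle>B u, u\<rangle>"

definition dual_norm :: "('a::euclidean_space \<Rightarrow> 'a dual) \<Rightarrow> 'a dual \<Rightarrow> real" where
  "dual_norm B s = sqrt \<langle>s, inv B s\<rangle>"

definition operator_norm :: "('a::euclidean_space \<Rightarrow> 'a dual) \<Rightarrow> ('a \<Rightarrow> 'a dual) \<Rightarrow> real" where
  "operator_norm B A = (SUP u\<in>{u. primal_norm B u \<le> 1}. dual_norm B (A u))"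

text \<open>
  The library has trace and determinant for matrices only. For a linear endomorphism \<open>T\<close> we take
  those of its matrix in the standard basis; the entry in row \<open>a\<close> and column \<open>b\<close> is \<open>T b \<bullet> a\<close>.
\<close>

definition op_trace :: "('a::euclidean_space \<Rightarrow> 'a) \<Rightarrow> real" where
  "op_trace T = (\<Sum>b\<in>Basis. T b \<bullet> b)"

definition op_det :: "('a::euclidean_space \<Rightarrow> 'a) \<Rightarrow> real" where
  "op_det T = (\<Sum>p | p permutes Basis. of_int (sign p) * (\<Prod>b\<in>Basis. T (p b) \<bullet> b))"

lemma op_trace_eq_trace_matrix: "op_trace (T :: real^'n \<Rightarrow> real^'n) = trace (matrix T)"
proof -
  have inj: "inj (\<lambda>i::'n. axis i (1::real))"
    by (auto simp: inj_on_def axis_eq_axis)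
  have bas: "Basis = range (\<lambda>i::'n. axis i (1::real))"
    by (auto simp: Basis_vec_def)
  show ?thesis
    unfolding op_trace_def bas sum.reindex[OF inj]
    by (simp add: trace_def matrix_def inner_axis)
qed

lemma op_det_eq_det_matrix: "op_det (T :: real^'n \<Rightarrow> real^'n) = det (matrix T)"
proof -
  define e where "e = (\<lambda>i::'n. axis i (1::real))"
  have inj: "inj e"
    by (auto simp: e_def inj_on_def axis_eq_axis)
  have bas: "Basis = range e"
    by (auto simp: e_def Basis_vec_def)
  have map_perm: "map_permutation UNIV e
      = (\<lambda>p b. if b \<in> Basis then e (p (inv e b)) else b)"
    by (intro ext) (simp add: map_permutation_def restrict_id_def bas)
  have "bij_betw e UNIV Basis"
    using inj bas by (simp add: bij_betw_def)
  then have bij: "bij_betw (map_permutation UNIV e) {p. p permutes UNIV} {p. p permutes Basis}"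
    unfolding map_perm by (rule bij_betw_permutations)
  have "op_det T = (\<Sum>p | p permutes UNIV. of_int (sign (map_permutation UNIV e p)) *
      (\<Prod>b\<in>Basis. T (map_permutation UNIV e p b) \<bullet> b))"
    unfolding op_det_def by (rule sum.reindex_bij_betw[OF bij, symmetric])
  also have "\<dots> = det (matrix T)"
    unfolding det_def
  proof (rule sum.cong, simp)
    fix p :: "'n \<Rightarrow> 'n" assume "p \<in> {p. p permutes UNIV}"
    then have "sign (map_permutation UNIV e p) = sign p"
      using inj by (simp add: sign_map_permutation)
    moreover have "(\<Prod>b\<in>Basis. T (map_permutation UNIV e p b) \<bullet> b)
        = (\<Prod>i\<in>UNIV. matrix T $ i $ p i)"
      using inj by (simp add: bas prod.reindex map_permutation_apply)
        (simp add: e_def matrix_def inner_axis)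
    ultimately show "of_int (sign (map_permutation UNIV e p)) *
        (\<Prod>b\<in>Basis. T (map_permutation UNIV e p b) \<bullet> b)
        = of_int (sign p) * (\<Prod>i\<in>UNIV. matrix T $ i $ p i)"
      by simp
  qed
  finally show ?thesis .
qed

definition psi :: "('a::euclidean_space \<Rightarrow> 'a dual) \<Rightarrow> ('a \<Rightarrow> 'a dual) \<Rightarrow> real" where
  "psi X Y = op_trace (\<lambda>u. inv X (Y u - X u)) - ln (op_det (\<lambda>u. inv X (Y u)))"

definition omega_star :: "real \<Rightarrow> real" where
  "omega_star \<tau> = - \<tau> - ln (1 - \<tau>)"

text \<open>
  The gradient and the Hessian are given as functions \<open>g\<close> and \<open>h\<close>; they are determined by \<open>f\<close>
  because derivatives on the whole space are unique.
\<close>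

definition twice_differentiable_with ::
  "('a::euclidean_space \<Rightarrow> real) \<Rightarrow> ('a \<Rightarrow> 'a dual) \<Rightarrow> ('a \<Rightarrow> 'a \<Rightarrow> 'a dual) \<Rightarrow> bool" where
  "twice_differentiable_with f g h \<longleftrightarrow>
     (\<forall>x. (f has_derivative blinfun_apply (g x)) (at x)) \<and>
     (\<forall>x. (g has_derivative h x) (at x))"

definition bfgs_update ::
  "('a::euclidean_space dual \<Rightarrow> 'a) \<Rightarrow> 'a \<Rightarrow> 'a dual \<Rightarrow> 'a dual \<Rightarrow> 'a" where
  "bfgs_update H \<delta> \<gamma> = (\<lambda>s.
     H s - (1 / \<langle>\<gamma>, \<delta>\<rangle>) *\<^sub>R (\<langle>s, \<delta>\<rangle> *\<^sub>R H \<gamma> + \<langle>\<gamma>, H s\<rangle> *\<^sub>R \<delta>)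
         + ((\<langle>\<gamma>, H \<gamma>\<rangle> / \<langle>\<gamma>, \<delta>\<rangle> + 1) * (\<langle>s, \<delta>\<rangle> / \<langle>\<gamma>, \<delta>\<rangle>)) *\<^sub>R \<delta>)"

text \<open>
  Iterates \<open>x\<close>, inverse Hessian approximations \<open>H\<close> and step sizes \<open>h\<close>; \<open>x 0\<close> is arbitrary. Only
  \<open>H 0\<close> is required to be positive definite, and the curvature condition \<open>\<langle>\<gamma>, \<delta>\<rangle> > 0\<close> is not
  included.
\<close>

definition bfgs_method ::
  "('a::euclidean_space \<Rightarrow> 'a dual) \<Rightarrow> (nat \<Rightarrow> 'a) \<Rightarrow> (nat \<Rightarrow> 'a dual \<Rightarrow> 'a) \<Rightarrow> (nat \<Rightarrow> real) \<Rightarrow> bool"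
  where
  "bfgs_method g x H h \<longleftrightarrow> spd_dual_op (H 0) \<and>
     (\<forall>k. h k > 0 \<and>
          x (Suc k) = x k - h k *\<^sub>R H k (g (x k)) \<and>
          H (Suc k) = bfgs_update (H k) (x (Suc k) - x k) (g (x (Suc k)) - g (x k)))"

definition armijo ::
  "('a::euclidean_space \<Rightarrow> real) \<Rightarrow> ('a \<Rightarrow> 'a dual) \<Rightarrow> real \<Rightarrow> 'a \<Rightarrow> 'a \<Rightarrow> nat \<Rightarrow> bool" where
  "armijo f g \<eta> x d i \<longleftrightarrow> f x - f (x - (1 / 2 ^ i) *\<^sub>R d) \<ge> \<eta> * (1 / 2 ^ i) * \<langle>g x, d\<rangle>"

end

theory Submission
  imports Defs
begin

text \<open>
  Write \<open>A\<close> for the Hessian at the minimizer and \<open>G\<close> for the inverse of the current \<open>H\<close>. One update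
  changes \<open>psi A G\<close> by at most \<open>2 * Hc * \<sigma> - \<Delta>\<close>, where \<open>\<Delta> \<ge> 0\<close> measures how far \<open>G \<delta>\<close> is from \<open>A \<delta>\<close>; as
  \<open>psi A G \<ge> 0\<close>, the sum of all \<open>\<Delta>\<close> is at most \<open>\<Omega>\<close>. Put \<open>D = 1 / (\<Upsilon> + 3.02) < omega_star tbar\<close>. If
  \<open>\<Delta> < D\<close> in the local region, the unit step passes the line search and the direction is close to
  Newton's, so that \<open>\<sigma>\<close> shrinks by the factor \<open>exp (- 0.85 * (1 - \<Delta> / D))\<close>. If \<open>\<Delta> \<ge> D\<close> this factor is
  at least 1 and the same bound follows from monotonicity of \<open>f (x k)\<close>. After \<open>k \<ge> 7 * \<Omega> / D\<close> steps the
  product of the factors is at most \<open>exp (- 0.85 * (6 / 7) * k)\<close>, and \<open>0.85 * 6 / 7 > ln 2\<close>; the excess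
  pays for passing between \<open>\<sigma>\<close> and \<open>r\<close>.
\<close>

section \<open>Trace and determinant of rank one perturbations\<close>

text \<open>No single BFGS step need contract: only the sum of the \<open>\<Delta> k\<close> is
  controlled, and some steps may be bad. The bound on a step is therefore the exponential of an
  affine function of \<open>\<Delta> k\<close>: the product over many steps depends on the sum
  alone, and good steps need not be counted. As \<open>\<Delta> k\<close> \<ge> 0, the sum from
  \<open>K0L\<close> on is covered by the sum from 0. The potential estimate must hold from the very
  start, far from the minimizer, so the secant bounds behind it avoid any smallness condition on
  \<open>rho\<close>. Smallness enters only through the unit step. \<open>1 - tbar\<close> is a
  lower bound for \<open>\<langle>G d, d\<rangle> / \<langle>A d, d\<rangle>\<close> that still lets
  the unit step pass, with the factor 0.9 reserving room for the variation of the Hessian;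
  \<open>omega_star tbar\<close> is the matching threshold for \<open>\<Delta>\<close>. That
  threshold alone is too large: it approaches 0.148 as \<open>\<eta>1\<close> tends to 0, and at
  \<open>\<Delta>\<close> near 0.148 the estimated factor exceeds 1. The summand 3.02 pushes
  \<open>D\<close> below 0.10325, where the exponential bound holds on the whole range 0 \<le>
  \<open>\<Delta>\<close> \<le> \<open>D\<close>.\<close>

lemma op_det_cong:
  assumes "\<And>b. b \<in> Basis \<Longrightarrow> c b = c' b"
  shows "op_det c = op_det (c' :: 'a::euclidean_space \<Rightarrow> 'a)"
  unfolding op_det_def
  by (intro sum.cong prod.cong refl arg_cong2[where f="(*)"])
    (auto simp: assms permutes_in_image)

lemma op_det_id: "op_det (\<lambda>b::'a::euclidean_space. b) = 1"
proof -
  have "(\<Prod>b\<in>Basis. p b \<bullet> b) = (0::real)"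
    if p: "p permutes (Basis :: 'a set)" and ne: "p \<noteq> id" for p
  proof -
    obtain b where b: "p b \<noteq> b" using ne by fastforce
    with p have "b \<in> Basis" by (metis permutes_not_in)
    with p b show ?thesis
      by (intro prod_zero) (auto intro!: bexI[of _ b] simp: inner_Basis permutes_in_image)
  qed
  then have "op_det (\<lambda>b::'a. b) = (\<Sum>p\<in>{id}. of_int (sign p) * (\<Prod>b\<in>Basis. p b \<bullet> (b::'a)))"
    unfolding op_det_def
    by (intro sum.mono_neutral_right) (auto simp: finite_permutations permutes_id)
  then show ?thesis
    by (simp add: sign_id inner_Basis)
qed

text \<open>\<open>op_det\<close> reads its argument only on \<open>Basis\<close>, so it is treated
  as a function of a family of columns, and \<open>c(b0 := z)\<close> replaces one column. That
  column meets each permutation in exactly one factor, at row \<open>inv p b0\<close>; isolating it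
  makes linearity in \<open>z\<close> visible.\<close>

lemma op_det_column_expand:
  fixes c :: "'a::euclidean_space \<Rightarrow> 'a"
  assumes "b0 \<in> Basis"
  shows "op_det (c(b0 := z)) = (\<Sum>p | p permutes Basis. of_int (sign p) *
    ((z \<bullet> inv p b0) * (\<Prod>b\<in>Basis - {inv p b0}. c (p b) \<bullet> b)))"
  unfolding op_det_def
proof (rule sum.cong[OF refl], rule arg_cong2[where f="(*)", OF refl])
  fix p :: "'a \<Rightarrow> 'a" assume "p \<in> {p. p permutes Basis}"
  then have p: "p permutes Basis" by simp
  let ?b = "inv p b0"
  have b: "?b \<in> Basis" using p assms by (metis permutes_inv permutes_in_image)
  have pb: "p ?b = b0" using p by (metis permutes_inverses(1))
  have ne: "p b \<noteq> b0" if "b \<noteq> ?b" for b using that p by (metis permutes_inverses(2))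
  have "(\<Prod>b\<in>Basis. (c(b0 := z)) (p b) \<bullet> b)
      = ((c(b0 := z)) (p ?b) \<bullet> ?b) * (\<Prod>b\<in>Basis - {?b}. (c(b0 := z)) (p b) \<bullet> b)"
    by (rule prod.remove) (use b in auto)
  also have "\<dots> = (z \<bullet> ?b) * (\<Prod>b\<in>Basis - {?b}. c (p b) \<bullet> b)"
    using ne by (intro arg_cong2[where f="(*)"] prod.cong) (auto simp: pb)
  finally show "(\<Prod>b\<in>Basis. (c(b0 := z)) (p b) \<bullet> b) = \<dots>" .
qed

lemma linear_op_det_column:
  fixes c :: "'a::euclidean_space \<Rightarrow> 'a"
  assumes "b0 \<in> Basis"
  shows "linear (\<lambda>z. op_det (c(b0 := z)))"
  unfolding op_det_column_expand[OF assms]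
  by (intro linearI) (simp_all add: inner_add_left algebra_simps sum.distrib sum_distrib_left)

text \<open>Composing every permutation with the transposition of the two columns flips all signs
  and leaves all products unchanged, so the sum equals its own negative.\<close>

lemma op_det_identical_columns:
  fixes c :: "'a::euclidean_space \<Rightarrow> 'a"
  assumes b: "b0 \<in> Basis" "b1 \<in> Basis" "b0 \<noteq> b1" and eq: "c b0 = c b1"
  shows "op_det c = 0"
proof -
  let ?t = "Transposition.transpose b0 b1"
  have t: "?t permutes Basis" using b by (simp add: permutes_swap_id)
  have ct: "c (?t b) = c b" for b
    using eq by (auto simp: Transposition.transpose_def)
  have "op_det c = (\<Sum>p | p permutes Basis. of_int (sign (?t \<circ> p)) * (\<Prod>b\<in>Basis. c ((?t \<circ> p) b) \<bullet> b))"
    unfolding op_det_def by (rule setum_permutations_compose_left[OF t])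
  also have "\<dots> = (\<Sum>p | p permutes Basis. - (of_int (sign p) * (\<Prod>b\<in>Basis. c (p b) \<bullet> b)))"
  proof (rule sum.cong[OF refl])
    fix p :: "'a \<Rightarrow> 'a" assume "p \<in> {p. p permutes Basis}"
    then have "permutation p" "permutation ?t"
      using t permutes_imp_permutation[OF finite_Basis] by auto
    then have "sign (?t \<circ> p) = - sign p"
      using b by (simp add: sign_compose sign_swap_id)
    then show "of_int (sign (?t \<circ> p)) * (\<Prod>b\<in>Basis. c ((?t \<circ> p) b) \<bullet> b)
        = - (of_int (sign p) * (\<Prod>b\<in>Basis. c (p b) \<bullet> b))"
      by (simp add: ct)
  qed
  also have "\<dots> = - op_det c" by (simp add: op_det_def sum_negf)
  finally show ?thesis by simp
qed

lemma op_det_add_to_columns: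
  fixes c :: "'a::euclidean_space \<Rightarrow> 'a"
  assumes b0: "b0 \<in> Basis" and "finite A" "A \<subseteq> Basis - {b0}"
  shows "op_det ((\<lambda>b. if b \<in> A then c b + \<phi> b *\<^sub>R z else c b)(b0 := z)) = op_det (c(b0 := z))"
  using assms(2,3)
proof (induction A)
  case (insert a A)
  let ?c = "(\<lambda>b. if b \<in> A then c b + \<phi> b *\<^sub>R z else c b)(b0 := z)"
  have a: "a \<in> Basis" "a \<noteq> b0" using insert by auto
  note lin = linear_op_det_column[OF a(1), of ?c]
  have "(\<lambda>b. if b \<in> insert a A then c b + \<phi> b *\<^sub>R z else c b)(b0 := z) = ?c(a := c a + \<phi> a *\<^sub>R z)"
    using a by auto
  moreover have "op_det (?c(a := c a + \<phi> a *\<^sub>R z)) = op_det (?c(a := c a)) + \<phi> a * op_det (?c(a := z))"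
    using linear_add[OF lin] linear_scale[OF lin] by simp
  moreover have "?c(a := c a) = ?c" using a insert.hyps by auto
  moreover have "op_det (?c(a := z)) = 0"
    by (rule op_det_identical_columns[OF b0 a(1)]) (use a in auto)
  moreover have "op_det ?c = op_det (c(b0 := z))" using insert by blast
  ultimately show ?case by (simp only: mult_zero_right add_0_right)
qed simp

text \<open>Of the multilinear expansion only the terms of first order survive: a term with
  \<open>z\<close> in two columns vanishes. The induction moves one column at a time, and the
  preceding lemma removes the remaining multiples of \<open>z\<close> once \<open>z\<close> itself
  is a column.\<close>

lemma op_det_rank_one_columns:
  fixes c :: "'a::euclidean_space \<Rightarrow> 'a"
  assumes "finite A" "A \<subseteq> Basis"
  shows "op_det (\<lambda>b. if b \<in> A then c b + \<phi> b *\<^sub>R z else c b)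
    = op_det c + (\<Sum>b\<in>A. \<phi> b * op_det (c(b := z)))"
  using assms
proof (induction A)
  case (insert a A)
  let ?c = "\<lambda>b. if b \<in> A then c b + \<phi> b *\<^sub>R z else c b"
  have a: "a \<in> Basis" "A \<subseteq> Basis - {a}" using insert by auto
  note lin = linear_op_det_column[OF a(1), of ?c]
  have "(\<lambda>b. if b \<in> insert a A then c b + \<phi> b *\<^sub>R z else c b) = ?c(a := c a + \<phi> a *\<^sub>R z)"
    by auto
  moreover have "op_det (?c(a := c a + \<phi> a *\<^sub>R z)) = op_det (?c(a := c a)) + \<phi> a * op_det (?c(a := z))"
    using linear_add[OF lin] linear_scale[OF lin] by simp
  moreover have "?c(a := c a) = ?c" using insert.hyps by auto
  moreover have "op_det ?c = op_det c + (\<Sum>b\<in>A. \<phi> b * op_det (c(b := z)))"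
    using insert by blast
  ultimately show ?case
    by (simp only: op_det_add_to_columns[OF a(1) insert.hyps(1) a(2)] sum.insert[OF insert.hyps] add_ac)
qed simp

text \<open>Cramer's rule: \<open>T u\<close> is expanded in the columns \<open>T a\<close>, and
  every term with \<open>a\<close> different from \<open>b\<close> repeats a column.\<close>

lemma op_det_replace_column:
  fixes T :: "'a::euclidean_space \<Rightarrow> 'a"
  assumes T: "linear T" and b: "b \<in> Basis"
  shows "op_det (T(b := T u)) = (u \<bullet> b) * op_det T"
proof -
  note lin = linear_op_det_column[OF b, of T]
  have "T u = (\<Sum>a\<in>Basis. (u \<bullet> a) *\<^sub>R T a)"
    by (metis (no_types, lifting) T euclidean_representation linear_scale linear_sum sum.cong)
  then have "op_det (T(b := T u)) = (\<Sum>a\<in>Basis. (u \<bullet> a) * op_det (T(b := T a)))"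
    by (simp only: linear_sum[OF lin] linear_scale[OF lin] real_scaleR_def)
  also have "\<dots> = (\<Sum>a\<in>Basis. if a = b then (u \<bullet> b) * op_det T else 0)"
  proof (rule sum.cong[OF refl])
    fix a :: 'a assume a: "a \<in> Basis"
    show "(u \<bullet> a) * op_det (T(b := T a)) = (if a = b then (u \<bullet> b) * op_det T else 0)"
      using op_det_identical_columns[OF a b, of "T(b := T a)"] by auto
  qed
  finally show ?thesis using b by simp
qed

lemma linear_functional_representation:
  fixes \<phi> :: "'a::euclidean_space \<Rightarrow> real"
  assumes "linear \<phi>"
  shows "(\<Sum>b\<in>Basis. (u \<bullet> b) * \<phi> b) = \<phi> u"
proof -
  have "\<phi> u = (\<Sum>b\<in>Basis. \<phi> ((u \<bullet> b) *\<^sub>R b))"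
    by (metis assms euclidean_representation linear_sum)
  then show ?thesis using linear_scale[OF assms] by simp
qed

text \<open>The matrix determinant lemma, with the perturbation of the identity placed to the right
  of \<open>T\<close>; this form needs no inverse of \<open>T\<close>.\<close>

lemma op_det_compose_rank_one:
  fixes T :: "'a::euclidean_space \<Rightarrow> 'a" and \<phi> :: "'a \<Rightarrow> real"
  assumes T: "linear T" and \<phi>: "linear \<phi>"
  shows "op_det (\<lambda>w. T (w + \<phi> w *\<^sub>R u)) = (1 + \<phi> u) * op_det T"
proof -
  have "op_det (\<lambda>w. T (w + \<phi> w *\<^sub>R u))
      = op_det (\<lambda>b. if b \<in> Basis then T b + \<phi> b *\<^sub>R T u else T b)"
    by (rule op_det_cong) (simp add: linear_add[OF T] linear_scale[OF T])
  also have "\<dots> = op_det T + (\<Sum>b\<in>Basis. \<phi> b * op_det (T(b := T u)))"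
    by (rule op_det_rank_one_columns) auto
  also have "(\<Sum>b\<in>Basis. \<phi> b * op_det (T(b := T u))) = (\<Sum>b\<in>Basis. (u \<bullet> b) * \<phi> b) * op_det T"
    unfolding sum_distrib_right by (intro sum.cong) (simp_all add: op_det_replace_column[OF T])
  also have "(\<Sum>b\<in>Basis. (u \<bullet> b) * \<phi> b) = \<phi> u"
    by (rule linear_functional_representation[OF \<phi>])
  finally show ?thesis by (simp add: algebra_simps)
qed

lemma op_trace_rank_one:
  fixes \<phi> :: "'a::euclidean_space \<Rightarrow> real"
  assumes "linear \<phi>"
  shows "op_trace (\<lambda>w. \<phi> w *\<^sub>R u) = \<phi> u"
  using linear_functional_representation[OF assms, of u] by (simp add: op_trace_def mult.commute)

lemma op_trace_add: "op_trace (\<lambda>w. S w + T w) = op_trace S + op_trace T"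
  by (simp add: op_trace_def inner_add_left sum.distrib)

lemma op_trace_diff: "op_trace (\<lambda>w. S w - T w) = op_trace S - op_trace T"
  by (simp add: op_trace_def inner_diff_left sum_subtractf)

section \<open>The BFGS update and its potential\<close>

lemma spd_opD:
  assumes "spd_op X"
  shows "linear X" "\<langle>X u, v\<rangle> = \<langle>X v, u\<rangle>" "u \<noteq> 0 \<Longrightarrow> \<langle>X u, u\<rangle> > 0"
  using assms unfolding spd_op_def by blast+

lemma spd_op_nonneg: "spd_op X \<Longrightarrow> \<langle>X u, u\<rangle> \<ge> 0"
  using spd_opD(3)[of X u] linear_0[OF spd_opD(1), of X] by (cases "u = 0") (auto intro: less_imp_le)

lemma linear_pairing: "linear (\<lambda>u. \<langle>s, u\<rangle>)"
  by (rule linearI) (simp_all add: blinfun.add_right blinfun.scaleR_right)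

lemma linear_inv_bij:
  fixes f :: "'a::real_vector \<Rightarrow> 'b::real_vector"
  assumes "linear f" "bij f"
  shows "linear (inv f)"
proof (rule linearI)
  show "inv f (x + y) = inv f x + inv f y" for x y
    by (rule inv_f_eq[OF bij_is_inj[OF assms(2)]])
      (simp add: linear_add[OF assms(1)] surj_f_inv_f[OF bij_is_surj[OF assms(2)]])
  show "inv f (c *\<^sub>R x) = c *\<^sub>R inv f x" for c x
    by (rule inv_f_eq[OF bij_is_inj[OF assms(2)]])
      (simp add: linear_scale[OF assms(1)] surj_f_inv_f[OF bij_is_surj[OF assms(2)]])
qed

lemma pairing_representation:
  fixes s :: "'a::euclidean_space dual"
  obtains z where "\<And>u. \<langle>s, u\<rangle> = z \<bullet> u"
proof
  show "\<langle>s, u\<rangle> = (\<Sum>b\<in>Basis. \<langle>s, b\<rangle> *\<^sub>R b) \<bullet> u" for u :: 'a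
    using linear_functional_representation[OF linear_pairing, of u s]
    by (simp add: inner_sum_left mult.commute inner_commute[of u])
qed

text \<open>Represents \<open>X\<close> by an endomorphism through the built-in inner product. This
  gives access to facts about endomorphisms: injectivity implies surjectivity, linear maps are
  continuous, and orthogonal complements exist.\<close>

lemma spd_op_riesz:
  fixes X :: "'a::euclidean_space \<Rightarrow> 'a dual"
  assumes "spd_op X"
  shows "\<exists>Y :: 'a \<Rightarrow> 'a. linear Y \<and> surj Y \<and> (\<forall>u v. \<langle>X u, v\<rangle> = Y u \<bullet> v)"
proof -
  define Y where "Y = (\<lambda>u. SOME z. \<forall>v. \<langle>X u, v\<rangle> = z \<bullet> v)"
  have Y: "\<langle>X u, v\<rangle> = Y u \<bullet> v" for u v
  proof -
    have "\<exists>z. \<forall>v. \<langle>X u, v\<rangle> = z \<bullet> v"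
      using pairing_representation[of "X u"] by metis
    then show ?thesis unfolding Y_def by (rule someI2_ex) simp
  qed
  note X = spd_opD[OF assms]
  have "linear Y"
  proof (rule linearI)
    show "Y (x + y) = Y x + Y y" for x y
      by (rule vector_eq_ldot[THEN iffD1])
        (simp add: inner_commute[of _ "Y _"] inner_add_right Y[symmetric] linear_add[OF X(1)] blinfun.add_left)
    show "Y (c *\<^sub>R x) = c *\<^sub>R Y x" for c x
      by (rule vector_eq_ldot[THEN iffD1])
        (simp add: inner_commute[of _ "Y _"] Y[symmetric] linear_scale[OF X(1)] blinfun.scaleR_left)
  qed
  moreover have "inj Y"
    unfolding linear_injective_0[OF \<open>linear Y\<close>]
    by (metis X(3) Y inner_zero_left less_irrefl)
  ultimately show ?thesis
    using Y linear_injective_imp_surjective by blast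
qed

lemma bij_spd_op:
  assumes "spd_op (X :: 'a::euclidean_space \<Rightarrow> 'a dual)"
  shows "bij X"
proof (rule bijI)
  note X = spd_opD[OF assms]
  show "inj X"
    unfolding linear_injective_0[OF X(1)] by (metis X(3) blinfun.zero_left less_irrefl)
  show "surj X"
    unfolding surj_def
  proof
    fix s :: "'a dual"
    obtain Y :: "'a \<Rightarrow> 'a" where Y: "linear Y" "surj Y" "\<And>u v. \<langle>X u, v\<rangle> = Y u \<bullet> v"
      using spd_op_riesz[OF assms] by metis
    obtain z where "\<And>u. \<langle>s, u\<rangle> = z \<bullet> u" using pairing_representation by blast
    with Y show "\<exists>u. s = X u" by (metis blinfun_eqI surjD)
  qed
qed

lemma spd_op_inv:
  assumes "spd_op (X :: 'a::euclidean_space \<Rightarrow> 'a dual)"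
  shows "X (inv X s) = s" "inv X (X u) = u" "linear (inv X)"
  using bij_spd_op[OF assms] linear_inv_bij[OF spd_opD(1)[OF assms]]
  by (simp_all add: surj_f_inv_f bij_is_surj bij_is_inj)

lemma spd_dual_op_inv:
  assumes "spd_dual_op (H :: 'a::euclidean_space dual \<Rightarrow> 'a)"
  shows "bij H" "spd_op (inv H)"
proof -
  have H: "linear H" "\<And>s t. \<langle>s, H t\<rangle> = \<langle>t, H s\<rangle>" "\<And>s. s \<noteq> 0 \<Longrightarrow> \<langle>s, H s\<rangle> > 0"
    using assms unfolding spd_dual_op_def by auto
  have inj: "inj H"
    unfolding linear_injective_0[OF H(1)] by (metis H(3) blinfun.zero_right less_irrefl)
  \<comment> \<open>Preceded by the embedding of the space into its dual, \<open>H\<close> becomes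
    an endomorphism, for which injectivity implies surjectivity.\<close>
  define f where "f = (\<lambda>u. H (blinfun_inner_right u))"
  have "linear f"
  proof (rule linearI)
    have "blinfun_inner_right (u + v) = blinfun_inner_right u + blinfun_inner_right v" for u v :: 'a
      by (rule blinfun_eqI) (simp add: blinfun.add_left inner_add_left)
    then show "f (u + v) = f u + f v" for u v by (simp add: f_def linear_add[OF H(1)])
    have "blinfun_inner_right (c *\<^sub>R u) = c *\<^sub>R blinfun_inner_right u" for c and u :: 'a
      by (rule blinfun_eqI) (simp add: blinfun.scaleR_left)
    then show "f (c *\<^sub>R u) = c *\<^sub>R f u" for c u by (simp add: f_def linear_scale[OF H(1)])
  qed
  moreover have "inj f"
  proof (rule injI)
    fix u v assume "f u = f v"
    then have "blinfun_inner_right u = blinfun_inner_right v" using inj by (auto simp: f_def dest: injD)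
    then have "u \<bullet> w = v \<bullet> w" for w by (metis blinfun_inner_right.rep_eq)
    then show "u = v" using vector_eq_rdot by blast
  qed
  ultimately have "surj f" by (simp add: linear_injective_imp_surjective)
  then have "surj H" unfolding f_def surj_def by metis
  with inj show bij: "bij H" by (rule bijI)
  have HH: "H (inv H u) = u" for u using \<open>surj H\<close> by (rule surj_f_inv_f)
  have lin: "linear (inv H)" by (rule linear_inv_bij[OF H(1) bij])
  show "spd_op (inv H)"
    unfolding spd_op_def
  proof (intro conjI allI impI lin)
    show "\<langle>inv H u, v\<rangle> = \<langle>inv H v, u\<rangle>" for u v using H(2)[of "inv H u" "inv H v"] by (simp add: HH)
    show "\<langle>inv H u, u\<rangle> > 0" if "u \<noteq> 0" for u
    proof -
      have "inv H u \<noteq> 0" using that HH linear_0[OF H(1)] by metis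
      from H(3)[OF this] show ?thesis by (simp add: HH)
    qed
  qed
qed

lemma spd_op_expand:
  assumes "spd_op X"
  shows "\<langle>X (u - t *\<^sub>R v), u - t *\<^sub>R v\<rangle> = \<langle>X u, u\<rangle> - 2 * t * \<langle>X u, v\<rangle> + t\<^sup>2 * \<langle>X v, v\<rangle>"
  using spd_opD(2)[OF assms, of v u]
  by (simp add: linear_diff[OF spd_opD(1)[OF assms]] linear_scale[OF spd_opD(1)[OF assms]]
      blinfun.diff_left blinfun.diff_right blinfun.scaleR_left blinfun.scaleR_right
      power2_eq_square algebra_simps)

lemma spd_op_cauchy_schwarz:
  assumes "spd_op X"
  shows "\<langle>X u, v\<rangle>\<^sup>2 \<le> \<langle>X u, u\<rangle> * \<langle>X v, v\<rangle>"
proof (cases "v = 0")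
  case False
  let ?t = "\<langle>X u, v\<rangle> / \<langle>X v, v\<rangle>"
  have v: "\<langle>X v, v\<rangle> > 0" using spd_opD(3)[OF assms False] .
  have "0 \<le> \<langle>X (u - ?t *\<^sub>R v), u - ?t *\<^sub>R v\<rangle>" by (rule spd_op_nonneg[OF assms])
  also have "\<dots> = \<langle>X u, u\<rangle> - \<langle>X u, v\<rangle>\<^sup>2 / \<langle>X v, v\<rangle>"
    using v unfolding spd_op_expand[OF assms] by (simp add: power2_eq_square field_simps)
  finally show ?thesis using v by (simp add: field_simps)
qed (simp add: spd_op_nonneg[OF assms])

text \<open>The update of the inverse \<open>G\<close> of \<open>H\<close>, a rank one removal
  followed by a rank one addition. The potential is computed on this form, where the two terms
  contribute separately to the trace.\<close>

definition bfgs_direct :: "('a::euclidean_space \<Rightarrow> 'a dual) \<Rightarrow> 'a \<Rightarrow> 'a dual \<Rightarrow> 'a \<Rightarrow> 'a dual" where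
  "bfgs_direct G \<delta> \<gamma> = (\<lambda>u. G u - (\<langle>G \<delta>, u\<rangle> / \<langle>G \<delta>, \<delta>\<rangle>) *\<^sub>R G \<delta> + (\<langle>\<gamma>, u\<rangle> / \<langle>\<gamma>, \<delta>\<rangle>) *\<^sub>R \<gamma>)"

lemma bfgs_direct_secant:
  assumes "\<langle>G \<delta>, \<delta>\<rangle> \<noteq> 0" "\<langle>\<gamma>, \<delta>\<rangle> \<noteq> 0"
  shows "bfgs_direct G \<delta> \<gamma> \<delta> = \<gamma>"
  using assms by (simp add: bfgs_direct_def)

text \<open>The removal leaves the form of \<open>G\<close> on the \<open>G\<close>-orthogonal
  projection of \<open>u\<close> off \<open>\<delta>\<close>. This is zero only on multiples of
  \<open>\<delta>\<close>, and there the added term is positive.\<close>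

lemma spd_bfgs_direct:
  assumes G: "spd_op G" and \<gamma>: "\<langle>\<gamma>, \<delta>\<rangle> > 0"
  shows "spd_op (bfgs_direct G \<delta> \<gamma>)"
  unfolding spd_op_def
proof (intro conjI allI impI)
  note G' = spd_opD[OF G]
  have G\<delta>: "\<langle>G \<delta>, \<delta>\<rangle> > 0" using \<gamma> G'(3)[of \<delta>] by (cases "\<delta> = 0") auto
  show "linear (bfgs_direct G \<delta> \<gamma>)"
    unfolding bfgs_direct_def
    by (rule linearI) (simp_all add: linear_add[OF G'(1)] linear_scale[OF G'(1)]
      blinfun.add_right blinfun.scaleR_right add_divide_distrib algebra_simps)
  show "\<langle>bfgs_direct G \<delta> \<gamma> u, v\<rangle> = \<langle>bfgs_direct G \<delta> \<gamma> v, u\<rangle>" for u v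
    unfolding bfgs_direct_def using G'(2)[of u v]
    by (simp add: blinfun.add_left blinfun.diff_left blinfun.scaleR_left mult_ac)
  show "\<langle>bfgs_direct G \<delta> \<gamma> u, u\<rangle> > 0" if "u \<noteq> 0" for u
  proof -
    let ?t = "\<langle>G u, \<delta>\<rangle> / \<langle>G \<delta>, \<delta>\<rangle>"
    let ?w = "u - ?t *\<^sub>R \<delta>"
    have "\<langle>G ?w, ?w\<rangle> = \<langle>G u, u\<rangle> - \<langle>G u, \<delta>\<rangle>\<^sup>2 / \<langle>G \<delta>, \<delta>\<rangle>"
      using G\<delta> unfolding spd_op_expand[OF G] by (simp add: power2_eq_square field_simps)
    then have eq: "\<langle>bfgs_direct G \<delta> \<gamma> u, u\<rangle> = \<langle>G ?w, ?w\<rangle> + \<langle>\<gamma>, u\<rangle>\<^sup>2 / \<langle>\<gamma>, \<delta>\<rangle>"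
      using G'(2)[of u \<delta>]
      by (simp add: bfgs_direct_def blinfun.add_left blinfun.diff_left blinfun.scaleR_left power2_eq_square)
    show ?thesis
    proof (cases "?w = 0")
      case True
      then have u: "u = ?t *\<^sub>R \<delta>" by simp
      with that have "?t \<noteq> 0" by (metis scaleR_zero_left)
      moreover have "\<langle>\<gamma>, u\<rangle> = ?t * \<langle>\<gamma>, \<delta>\<rangle>" by (subst u) (simp add: blinfun.scaleR_right)
      ultimately have "\<langle>\<gamma>, u\<rangle> \<noteq> 0" using \<gamma> by simp
      then have "\<langle>\<gamma>, u\<rangle>\<^sup>2 / \<langle>\<gamma>, \<delta>\<rangle> > 0" using \<gamma> by simp
      then show ?thesis using eq spd_op_nonneg[OF G, of ?w] by linarith
    next
      case False
      then have "\<langle>G ?w, ?w\<rangle> > 0" by (rule G'(3))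
      then show ?thesis using eq \<gamma> by (simp add: add_pos_nonneg)
    qed
  qed
qed

text \<open>One composition is enough: the direct update is positive definite, hence bijective, so a
  left inverse is the inverse.\<close>

lemma bfgs_update_bfgs_direct:
  assumes G: "spd_op G" and \<gamma>: "\<langle>\<gamma>, \<delta>\<rangle> > 0"
  shows "bfgs_update (inv G) \<delta> \<gamma> (bfgs_direct G \<delta> \<gamma> u) = u"
proof -
  note G' = spd_opD[OF G] and lin = spd_op_inv(3)[OF G]
  have G\<delta>: "\<langle>G \<delta>, \<delta>\<rangle> > 0" using \<gamma> G'(3)[of \<delta>] by (cases "\<delta> = 0") auto
  let ?t = "\<langle>G \<delta>, u\<rangle> / \<langle>G \<delta>, \<delta>\<rangle>" and ?c = "\<langle>\<gamma>, u\<rangle> / \<langle>\<gamma>, \<delta>\<rangle>"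
  let ?s = "bfgs_direct G \<delta> \<gamma> u"
  have s: "\<langle>?s, \<delta>\<rangle> = \<langle>\<gamma>, u\<rangle>"
    using G\<delta> \<gamma> G'(2)[of u \<delta>]
    by (simp add: bfgs_direct_def blinfun.add_left blinfun.diff_left blinfun.scaleR_left)
  have Hs: "inv G ?s = u - ?t *\<^sub>R \<delta> + ?c *\<^sub>R inv G \<gamma>"
    by (simp add: bfgs_direct_def linear_add[OF lin] linear_diff[OF lin] linear_scale[OF lin] spd_op_inv(2)[OF G])
  have \<gamma>Hs: "\<langle>\<gamma>, inv G ?s\<rangle> = \<langle>\<gamma>, u\<rangle> - ?t * \<langle>\<gamma>, \<delta>\<rangle> + ?c * \<langle>\<gamma>, inv G \<gamma>\<rangle>"
    by (simp add: Hs blinfun.add_right blinfun.diff_right blinfun.scaleR_right)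
  let ?m = "\<langle>\<gamma>, inv G \<gamma>\<rangle> / \<langle>\<gamma>, \<delta>\<rangle>"
  have coeff: "\<langle>\<gamma>, inv G ?s\<rangle> / \<langle>\<gamma>, \<delta>\<rangle> = ?c - ?t + ?c * ?m"
    unfolding \<gamma>Hs using \<gamma> by (simp add: field_simps)
  have "bfgs_update (inv G) \<delta> \<gamma> ?s = inv G ?s - ?c *\<^sub>R inv G \<gamma>
      - (\<langle>\<gamma>, inv G ?s\<rangle> / \<langle>\<gamma>, \<delta>\<rangle>) *\<^sub>R \<delta> + ((?m + 1) * ?c) *\<^sub>R \<delta>"
    unfolding bfgs_update_def s by (simp add: scaleR_add_right)
  also have "\<dots> = u" unfolding coeff unfolding Hs by (simp add: algebra_simps)
  finally show ?thesis .
qed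

lemma inv_bfgs_direct:
  assumes G: "spd_op G" and \<gamma>: "\<langle>\<gamma>, \<delta>\<rangle> > 0"
  shows "bfgs_update (inv G) \<delta> \<gamma> = inv (bfgs_direct G \<delta> \<gamma>)"
proof
  fix s
  show "bfgs_update (inv G) \<delta> \<gamma> s = inv (bfgs_direct G \<delta> \<gamma>) s"
    using bfgs_update_bfgs_direct[OF assms, of "inv (bfgs_direct G \<delta> \<gamma>) s"]
    by (simp add: spd_op_inv(1)[OF spd_bfgs_direct[OF assms]])
qed

lemma op_det_bfgs_direct:
  assumes A: "spd_op A" and G: "spd_op G" and \<gamma>: "\<langle>\<gamma>, \<delta>\<rangle> > 0"
  shows "op_det (\<lambda>u. inv A (bfgs_direct G \<delta> \<gamma> u)) = \<langle>\<gamma>, \<delta>\<rangle> / \<langle>G \<delta>, \<delta>\<rangle> * op_det (\<lambda>u. inv A (G u))"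
proof -
  note G' = spd_opD[OF G] and linA = spd_op_inv(3)[OF A] and linG = spd_op_inv(3)[OF G]
  have G\<delta>: "\<langle>G \<delta>, \<delta>\<rangle> > 0" using \<gamma> G'(3)[of \<delta>] by (cases "\<delta> = 0") auto
  define T where "T = (\<lambda>u. inv A (G u))"
  define w where "w = inv G \<gamma>"
  define \<phi> where "\<phi> = (\<lambda>u. \<langle>G \<delta>, u\<rangle> / \<langle>G \<delta>, \<delta>\<rangle>)"
  define \<xi> where "\<xi> = (\<lambda>u. \<langle>\<gamma>, u\<rangle> / \<langle>\<gamma>, \<delta>\<rangle>)"
  define \<alpha> where "\<alpha> = (\<lambda>u. \<xi> u - \<phi> u)"
  \<comment> \<open>Chosen so that the move along \<open>q\<close> followed by the move along
    \<open>\<delta>\<close> amounts to subtracting \<open>\<phi> u\<close> times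
    \<open>\<delta>\<close> and adding \<open>\<xi> u\<close> times \<open>w\<close>. The last
    summand of \<open>q\<close> compensates for the value of \<open>\<alpha>\<close> on
    \<open>q\<close>, which equals \<open>\<alpha> w\<close>.\<close>
  define q where "q = w - \<delta> - \<alpha> w *\<^sub>R \<delta>"
  have lin: "linear \<phi>" "linear \<xi>" "linear \<alpha>"
    unfolding \<alpha>_def \<phi>_def \<xi>_def
    by (auto intro!: linearI simp: blinfun.add_right blinfun.scaleR_right add_divide_distrib field_simps)
  have T: "linear T"
    unfolding T_def using linear_compose[OF G'(1) linA] by (simp add: o_def)
  \<comment> \<open>The update is a composition of two rank one perturbations of the identity;
    \<open>\<alpha> \<delta> = 0\<close> makes the first one volume preserving.\<close>
  have one: "\<phi> \<delta> = 1" "\<xi> \<delta> = 1" "\<alpha> \<delta> = 0"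
    using G\<delta> \<gamma> by (simp_all add: \<phi>_def \<xi>_def \<alpha>_def)
  have "\<alpha> q = \<alpha> w"
    by (simp add: q_def linear_diff[OF lin(3)] linear_scale[OF lin(3)] one)
  have "inv A (bfgs_direct G \<delta> \<gamma> u) = T (u + \<xi> u *\<^sub>R q + \<alpha> (u + \<xi> u *\<^sub>R q) *\<^sub>R \<delta>)" for u
  proof -
    have "u + \<xi> u *\<^sub>R q + \<alpha> (u + \<xi> u *\<^sub>R q) *\<^sub>R \<delta> = u - \<phi> u *\<^sub>R \<delta> + \<xi> u *\<^sub>R w"
      unfolding linear_add[OF lin(3)] linear_scale[OF lin(3)] \<open>\<alpha> q = \<alpha> w\<close>
      by (simp add: q_def \<alpha>_def algebra_simps)
    moreover have "T (u - \<phi> u *\<^sub>R \<delta> + \<xi> u *\<^sub>R w) = inv A (bfgs_direct G \<delta> \<gamma> u)"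
      unfolding T_def
      by (simp add: linear_add[OF G'(1)] linear_diff[OF G'(1)] linear_scale[OF G'(1)] w_def spd_op_inv(1)[OF G]
          \<phi>_def \<xi>_def bfgs_direct_def)
    ultimately show ?thesis by (simp only:)
  qed
  then have "op_det (\<lambda>u. inv A (bfgs_direct G \<delta> \<gamma> u))
      = op_det (\<lambda>u. T (u + \<xi> u *\<^sub>R q + \<alpha> (u + \<xi> u *\<^sub>R q) *\<^sub>R \<delta>))" by simp
  also have "\<dots> = (1 + \<xi> q) * op_det (\<lambda>u. T (u + \<alpha> u *\<^sub>R \<delta>))"
  proof (rule op_det_compose_rank_one[OF _ lin(2)])
    show "linear (\<lambda>u. T (u + \<alpha> u *\<^sub>R \<delta>))"
      by (rule linearI) (simp_all add: linear_add[OF T] linear_scale[OF T] linear_add[OF lin(3)]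
          linear_scale[OF lin(3)] algebra_simps)
  qed
  also have "op_det (\<lambda>u. T (u + \<alpha> u *\<^sub>R \<delta>)) = op_det T"
    using op_det_compose_rank_one[OF T lin(3), of \<delta>] by (simp add: one)
  also have "1 + \<xi> q = \<phi> w"
    by (simp add: q_def linear_diff[OF lin(2)] linear_scale[OF lin(2)] one) (simp add: \<alpha>_def)
  also have "\<phi> w = \<langle>\<gamma>, \<delta>\<rangle> / \<langle>G \<delta>, \<delta>\<rangle>"
    using G'(2)[of \<delta> w] by (simp add: \<phi>_def w_def spd_op_inv(1)[OF G])
  finally show ?thesis by (simp add: T_def)
qed

text \<open>The drop of \<open>psi A\<close> under an exact update, that is, one with
  \<open>\<gamma> = A \<delta>\<close>. It vanishes when
  \<open>G \<delta> = A \<delta>\<close>.\<close>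

definition bfgs_decrease :: "('a::euclidean_space \<Rightarrow> 'a dual) \<Rightarrow> ('a \<Rightarrow> 'a dual) \<Rightarrow> 'a \<Rightarrow> real" where
  "bfgs_decrease A G \<delta> = \<langle>G \<delta>, inv A (G \<delta>)\<rangle> / \<langle>G \<delta>, \<delta>\<rangle> - 1 - ln (\<langle>G \<delta>, \<delta>\<rangle> / \<langle>A \<delta>, \<delta>\<rangle>)"

text \<open>The logarithm of the determinant ratio is split at
  \<open>\<langle>A \<delta>, \<delta>\<rangle>\<close>, so that \<open>G \<delta>\<close> and
  \<open>\<gamma>\<close> are each compared with \<open>A \<delta>\<close> on their own. The final
  bracket is the error caused by \<open>\<gamma>\<close> differing from
  \<open>A \<delta>\<close>.\<close>

lemma psi_bfgs_direct:
  assumes A: "spd_op A" and G: "spd_op G" and \<gamma>: "\<langle>\<gamma>, \<delta>\<rangle> > 0"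
    and det: "op_det (\<lambda>u. inv A (G u)) > 0"
  shows "psi A (bfgs_direct G \<delta> \<gamma>) = psi A G - bfgs_decrease A G \<delta>
    + (\<langle>\<gamma>, inv A \<gamma>\<rangle> / \<langle>\<gamma>, \<delta>\<rangle> - 1 - ln (\<langle>\<gamma>, \<delta>\<rangle> / \<langle>A \<delta>, \<delta>\<rangle>))"
proof -
  note G' = spd_opD[OF G] and lin = spd_op_inv(3)[OF A]
  have \<delta>: "\<delta> \<noteq> 0" using \<gamma> by auto
  have pos: "\<langle>G \<delta>, \<delta>\<rangle> > 0" "\<langle>A \<delta>, \<delta>\<rangle> > 0"
    using spd_opD(3)[OF G \<delta>] spd_opD(3)[OF A \<delta>] .
  let ?\<phi> = "\<lambda>u. \<langle>G \<delta>, u\<rangle> / \<langle>G \<delta>, \<delta>\<rangle>" and ?\<xi> = "\<lambda>u. \<langle>\<gamma>, u\<rangle> / \<langle>\<gamma>, \<delta>\<rangle>"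
  have linf: "linear ?\<phi>" "linear ?\<xi>"
    by (auto intro!: linearI simp: blinfun.add_right blinfun.scaleR_right add_divide_distrib)
  have "op_trace (\<lambda>u. inv A (bfgs_direct G \<delta> \<gamma> u - A u))
      = op_trace (\<lambda>u. inv A (G u - A u) - ?\<phi> u *\<^sub>R inv A (G \<delta>) + ?\<xi> u *\<^sub>R inv A \<gamma>)"
    by (rule arg_cong[where f = op_trace])
      (simp add: fun_eq_iff bfgs_direct_def linear_add[OF lin] linear_diff[OF lin] linear_scale[OF lin])
  also have "\<dots> = op_trace (\<lambda>u. inv A (G u - A u)) - \<langle>G \<delta>, inv A (G \<delta>)\<rangle> / \<langle>G \<delta>, \<delta>\<rangle>
      + \<langle>\<gamma>, inv A \<gamma>\<rangle> / \<langle>\<gamma>, \<delta>\<rangle>"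
    unfolding op_trace_add op_trace_diff op_trace_rank_one[OF linf(1)] op_trace_rank_one[OF linf(2)] ..
  finally show ?thesis
    using pos \<gamma> det by (simp add: psi_def bfgs_decrease_def op_det_bfgs_direct[OF A G \<gamma>] ln_mult ln_div)
qed

lemma spd_op_dual_cauchy_schwarz:
  assumes "spd_op A"
  shows "\<langle>s, u\<rangle>\<^sup>2 \<le> \<langle>s, inv A s\<rangle> * \<langle>A u, u\<rangle>"
  using spd_op_cauchy_schwarz[OF assms, of "inv A s" u] by (simp add: spd_op_inv(1)[OF assms])

text \<open>By Cauchy-Schwarz the first quotient in the decrease is at least \<open>q\<close>. The
  right hand side is \<open>omega_star (1 - q)\<close>, which links the decrease to the threshold
  \<open>omega_star tbar\<close>.\<close>

lemma bfgs_decrease_ge: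
  assumes A: "spd_op A" and G: "spd_op G" and \<delta>: "\<delta> \<noteq> 0"
  defines "q \<equiv> \<langle>G \<delta>, \<delta>\<rangle> / \<langle>A \<delta>, \<delta>\<rangle>"
  shows "bfgs_decrease A G \<delta> \<ge> q - 1 - ln q"
proof -
  have pos: "\<langle>G \<delta>, \<delta>\<rangle> > 0" "\<langle>A \<delta>, \<delta>\<rangle> > 0"
    using spd_opD(3)[OF G \<delta>] spd_opD(3)[OF A \<delta>] .
  have "q \<le> \<langle>G \<delta>, inv A (G \<delta>)\<rangle> / \<langle>G \<delta>, \<delta>\<rangle>"
    using spd_op_dual_cauchy_schwarz[OF A, of "G \<delta>" \<delta>] pos
    by (simp add: q_def field_simps power2_eq_square)
  then show ?thesis unfolding bfgs_decrease_def q_def by simp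
qed

lemma bfgs_decrease_nonneg:
  assumes A: "spd_op A" and G: "spd_op G" and \<delta>: "\<delta> \<noteq> 0"
  shows "bfgs_decrease A G \<delta> \<ge> 0"
proof -
  have "\<langle>G \<delta>, \<delta>\<rangle> / \<langle>A \<delta>, \<delta>\<rangle> > 0"
    using spd_opD(3)[OF G \<delta>] spd_opD(3)[OF A \<delta>] by simp
  from ln_le_minus_one[OF this] bfgs_decrease_ge[OF assms] show ?thesis by linarith
qed

text \<open>Lets the decrease, which the potential produces for the actual step
  \<open>\<delta>\<close>, be read off the search direction whatever the step size.\<close>

lemma bfgs_decrease_scaleR:
  assumes A: "spd_op A" and G: "spd_op G" and c: "c \<noteq> 0"
  shows "bfgs_decrease A G (c *\<^sub>R \<delta>) = bfgs_decrease A G \<delta>"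
  using c
  by (simp add: bfgs_decrease_def linear_scale[OF spd_opD(1)[OF A]] linear_scale[OF spd_opD(1)[OF G]]
      linear_scale[OF spd_op_inv(3)[OF A]] blinfun.scaleR_left blinfun.scaleR_right)

text \<open>
  A BFGS update of \<open>G\<close> with \<open>\<gamma> = A \<delta>\<close> does not increase \<open>psi A G\<close>. If \<open>\<delta>\<close> is \<open>A\<close>-orthogonal to the
  subspace on which \<open>G\<close> and \<open>A\<close> agree, it enlarges that subspace by \<open>\<delta>\<close>, so that after finitely
  many updates \<open>G = A\<close> and \<open>psi A G = 0\<close>.
\<close>

lemma psi_nonneg:
  assumes A: "spd_op (A :: 'a::euclidean_space \<Rightarrow> 'a dual)" and "spd_op G"
  shows "op_det (\<lambda>u. inv A (G u)) > 0 \<and> psi A G \<ge> 0"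
  using assms(2)
proof (induction "DIM('a) - dim {w. G w = A w}" arbitrary: G rule: less_induct)
  case less
  note G = less.prems and G' = spd_opD[OF less.prems] and A' = spd_opD[OF A]
  let ?W = "{w. G w = A w}"
  have W: "subspace ?W"
    by (auto simp: subspace_def linear_0[OF G'(1)] linear_0[OF A'(1)] linear_add[OF G'(1)]
        linear_add[OF A'(1)] linear_scale[OF G'(1)] linear_scale[OF A'(1)])
  show ?case
  proof (cases "dim ?W = DIM('a)")
    case True
    then have "?W = UNIV" using W by (metis dim_eq_full span_eq_iff)
    then have "G = A" by (auto simp: fun_eq_iff)
    then show ?thesis
      by (simp add: psi_def spd_op_inv(2)[OF A] op_det_id linear_0[OF spd_op_inv(3)[OF A]] op_trace_def)
  next
    case False
    then have dim: "dim ?W < DIM('a)" using dim_subset_UNIV[of ?W] by linarith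
    obtain Y :: "'a \<Rightarrow> 'a" where Y: "linear Y" "surj Y" "\<And>u v. \<langle>A u, v\<rangle> = Y u \<bullet> v"
      using spd_op_riesz[OF A] by metis
    have "dim (Y ` ?W) < DIM('a)" using dim_image_le[OF Y(1), of ?W] dim by linarith
    then obtain \<delta> where \<delta>: "\<delta> \<noteq> 0" "\<And>z. z \<in> span (Y ` ?W) \<Longrightarrow> orthogonal \<delta> z"
      using orthogonal_to_subspace_exists[of "Y ` ?W"] by blast
    have orth: "\<langle>A w, \<delta>\<rangle> = 0" if "w \<in> ?W" for w
      using \<delta>(2)[OF span_base[OF imageI[OF that]]] Y(3)[of w \<delta>]
      by (simp add: orthogonal_def inner_commute)
    have pos: "\<langle>A \<delta>, \<delta>\<rangle> > 0" "\<langle>G \<delta>, \<delta>\<rangle> > 0" using A'(3) G'(3) \<delta>(1) by auto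
    define G1 where "G1 = bfgs_direct G \<delta> (A \<delta>)"
    have G1: "spd_op G1" unfolding G1_def by (rule spd_bfgs_direct[OF G pos(1)])
    let ?W1 = "{w. G1 w = A w}"
    have W1: "subspace ?W1"
      by (auto simp: subspace_def linear_0[OF spd_opD(1)[OF G1]] linear_0[OF A'(1)]
          linear_add[OF spd_opD(1)[OF G1]] linear_add[OF A'(1)]
          linear_scale[OF spd_opD(1)[OF G1]] linear_scale[OF A'(1)])
    have "?W \<subseteq> ?W1"
    proof
      \<comment> \<open>By symmetry of \<open>G\<close> and \<open>A\<close>, both
        \<open>\<langle>G \<delta>, w\<rangle>\<close> and
        \<open>\<langle>A \<delta>, w\<rangle>\<close> equal
        \<open>\<langle>A w, \<delta>\<rangle> = 0\<close>, so neither correction term changes the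
        value at \<open>w\<close>.\<close>
      fix w assume w: "w \<in> ?W"
      with orth[OF w] A'(2)[of w \<delta>] G'(2)[of w \<delta>] show "w \<in> ?W1"
        by (simp add: G1_def bfgs_direct_def)
    qed
    moreover have "\<delta> \<in> ?W1" using bfgs_direct_secant[of G \<delta> "A \<delta>"] pos by (simp add: G1_def)
    moreover have "\<delta> \<notin> ?W" using orth[of \<delta>] pos by auto
    ultimately have "?W \<subset> ?W1" by blast
    then have "dim ?W < dim ?W1"
      by (metis W W1 dim_psubset span_eq_iff)
    then have "DIM('a) - dim ?W1 < DIM('a) - dim ?W" using dim by linarith
    from less.hyps[OF this G1] have IH: "op_det (\<lambda>u. inv A (G1 u)) > 0" "psi A G1 \<ge> 0" by auto
    \<comment> \<open>Positivity of the determinant passes backwards from \<open>G1\<close> to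
      \<open>G\<close>, since the update multiplies it by a positive ratio. It is part of the
      induction because the logarithm in \<open>psi\<close> can only be split once it is
      known.\<close>
    have det: "op_det (\<lambda>u. inv A (G u)) > 0"
      using IH(1) pos unfolding G1_def op_det_bfgs_direct[OF A G pos(1)]
      by (simp add: zero_less_mult_iff zero_less_divide_iff)
    have "psi A G1 = psi A G - bfgs_decrease A G \<delta>"
      using pos by (simp add: G1_def psi_bfgs_direct[OF A G pos(1) det] spd_op_inv(2)[OF A])
    then show ?thesis using det IH(2) bfgs_decrease_nonneg[OF A G \<delta>(1)] by simp
  qed
qed

section \<open>Norms of positive definite operators\<close>

lemma primal_norm_power2:
  assumes "spd_op X"
  shows "(primal_norm X u)\<^sup>2 = \<langle>X u, u\<rangle>"
  by (simp add: primal_norm_def spd_op_nonneg[OF assms])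

lemma primal_norm_nonneg:
  assumes "spd_op X"
  shows "primal_norm X u \<ge> 0"
  by (simp add: primal_norm_def spd_op_nonneg[OF assms])

lemma primal_norm_eq_0:
  assumes "spd_op X"
  shows "primal_norm X u = 0 \<longleftrightarrow> u = 0"
  using spd_opD(3)[OF assms, of u] by (cases "u = 0") (auto simp: primal_norm_def)

lemma primal_norm_scaleR:
  assumes "spd_op X"
  shows "primal_norm X (c *\<^sub>R u) = \<bar>c\<bar> * primal_norm X u"
  by (simp add: primal_norm_def linear_scale[OF spd_opD(1)[OF assms]] blinfun.scaleR_left
      blinfun.scaleR_right real_sqrt_mult flip: mult.assoc)

lemma primal_norm_minus:
  assumes "spd_op X"
  shows "primal_norm X (- u) = primal_norm X u"
  using primal_norm_scaleR[OF assms, of "-1" u] by simp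

lemma abs_pairing_le:
  assumes "spd_op X"
  shows "\<bar>\<langle>X u, v\<rangle>\<bar> \<le> primal_norm X u * primal_norm X v"
  unfolding primal_norm_def real_sqrt_mult[symmetric]
  by (rule real_le_rsqrt) (simp add: spd_op_cauchy_schwarz[OF assms])

lemma primal_norm_triangle:
  assumes "spd_op X"
  shows "primal_norm X (u + v) \<le> primal_norm X u + primal_norm X v"
proof (rule power2_le_imp_le)
  have "\<langle>X (u + v), u + v\<rangle> = \<langle>X u, u\<rangle> + 2 * \<langle>X u, v\<rangle> + \<langle>X v, v\<rangle>"
    using spd_op_expand[OF assms, of u "-1" v] by simp
  then show "(primal_norm X (u + v))\<^sup>2 \<le> (primal_norm X u + primal_norm X v)\<^sup>2"
    using abs_pairing_le[OF assms, of u v]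
    by (simp add: primal_norm_power2[OF assms] power2_sum)
qed (simp add: primal_norm_nonneg[OF assms])

lemma dual_norm_eq:
  assumes "spd_op X"
  shows "dual_norm X s = primal_norm X (inv X s)"
  by (simp add: dual_norm_def primal_norm_def spd_op_inv(1)[OF assms])

lemma abs_pairing_le_dual:
  assumes "spd_op X"
  shows "\<bar>\<langle>s, v\<rangle>\<bar> \<le> dual_norm X s * primal_norm X v"
  using abs_pairing_le[OF assms, of "inv X s" v]
  by (simp add: dual_norm_eq[OF assms] spd_op_inv(1)[OF assms])

text \<open>Compactness of the Euclidean unit sphere. It serves to show that the supremum defining
  \<open>operator_norm\<close> is taken over a bounded set.\<close>

lemma primal_norm_equivalent:
  assumes B: "spd_op (B :: 'a::euclidean_space \<Rightarrow> 'a dual)"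
  shows "\<exists>m>0. \<exists>M. \<forall>u. m * norm u \<le> primal_norm B u \<and> primal_norm B u \<le> M * norm u"
proof -
  obtain Y :: "'a \<Rightarrow> 'a" where Y: "linear Y" "\<And>u v. \<langle>B u, v\<rangle> = Y u \<bullet> v"
    using spd_op_riesz[OF B] by metis
  have pn: "primal_norm B u = sqrt (Y u \<bullet> u)" for u by (simp add: primal_norm_def Y)
  have cont: "continuous_on (sphere 0 1) (primal_norm B)"
    unfolding pn[abs_def] by (intro continuous_intros linear_continuous_on)
      (use Y(1) in \<open>simp add: linear_conv_bounded_linear\<close>)
  have ne: "sphere (0::'a) 1 \<noteq> {}" by simp
  obtain a where a: "a \<in> sphere 0 1" "\<And>u. u \<in> sphere 0 1 \<Longrightarrow> primal_norm B a \<le> primal_norm B u"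
    using continuous_attains_inf[OF compact_sphere ne cont] by blast
  obtain b where b: "b \<in> sphere 0 1" "\<And>u. u \<in> sphere 0 1 \<Longrightarrow> primal_norm B u \<le> primal_norm B b"
    using continuous_attains_sup[OF compact_sphere ne cont] by blast
  have "a \<noteq> 0" using a(1) by auto
  then have "primal_norm B a > 0"
    using primal_norm_eq_0[OF B] primal_norm_nonneg[OF B] by (metis order_le_less)
  moreover have "primal_norm B a * norm u \<le> primal_norm B u \<and> primal_norm B u \<le> primal_norm B b * norm u" for u
  proof (cases "u = 0")
    case False
    have "primal_norm B u = norm u * primal_norm B ((1 / norm u) *\<^sub>R u)"
      using False by (simp add: primal_norm_scaleR[OF B])
    moreover have "(1 / norm u) *\<^sub>R u \<in> sphere 0 1" using False by simp
    ultimately show ?thesis using a(2) b(2) by (simp add: mult.commute mult_left_mono)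
  qed (simp add: primal_norm_eq_0[OF B, THEN iffD2])
  ultimately show ?thesis by blast
qed

text \<open>A real \<open>SUP\<close> says nothing unless the set is bounded above, so boundedness
  on the unit ball of \<open>B\<close> precedes the usual scaling argument.\<close>

lemma dual_norm_le_operator_norm:
  assumes B: "spd_op (B :: 'a::euclidean_space \<Rightarrow> 'a dual)" and A: "linear A"
  shows "dual_norm B (A u) \<le> operator_norm B A * primal_norm B u"
proof (cases "u = 0")
  case True
  then show ?thesis by (simp add: linear_0[OF A] dual_norm_def primal_norm_def)
next
  case False
  let ?T = "\<lambda>u. inv B (A u)"
  have T: "linear ?T" using linear_compose[OF A spd_op_inv(3)[OF B]] by (simp add: o_def)
  obtain m M where m: "m > 0" "\<And>u. m * norm u \<le> primal_norm B u" "\<And>u. primal_norm B u \<le> M * norm u"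
    using primal_norm_equivalent[OF B] by blast
  obtain K where K: "\<And>u. norm (?T u) \<le> K * norm u" "K > 0"
    using linear_bounded_pos[OF T] by blast
  have bdd: "bdd_above ((\<lambda>u. dual_norm B (A u)) ` {u. primal_norm B u \<le> 1})"
  proof (rule bdd_aboveI2)
    fix v assume "v \<in> {u. primal_norm B u \<le> 1}"
    then have "norm v \<le> 1 / m" using m(1) m(2)[of v] by (simp add: field_simps)
    then have "norm (?T v) \<le> K * (1 / m)" using K by (meson less_imp_le mult_left_mono order_trans)
    then have "\<bar>M\<bar> * norm (?T v) \<le> \<bar>M\<bar> * (K * (1 / m))" by (intro mult_left_mono) auto
    moreover have "M * norm (?T v) \<le> \<bar>M\<bar> * norm (?T v)" by (intro mult_right_mono) auto
    ultimately show "dual_norm B (A v) \<le> \<bar>M\<bar> * (K * (1 / m))"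
      using m(3)[of "?T v"] by (simp add: dual_norm_eq[OF B])
  qed
  have pos: "primal_norm B u > 0"
    using False primal_norm_eq_0[OF B] primal_norm_nonneg[OF B] by (metis order_le_less)
  let ?v = "(1 / primal_norm B u) *\<^sub>R u"
  have "primal_norm B ?v \<le> 1" using pos by (simp add: primal_norm_scaleR[OF B])
  then have "dual_norm B (A ?v) \<le> operator_norm B A"
    unfolding operator_norm_def by (intro cSUP_upper bdd) simp
  moreover have "dual_norm B (A ?v) = dual_norm B (A u) / primal_norm B u"
    using pos by (simp add: dual_norm_eq[OF B] linear_scale[OF T] primal_norm_scaleR[OF B])
  ultimately show ?thesis using pos by (simp add: field_simps)
qed

section \<open>Scalar inequalities\<close>

lemma powr_three_halves:
  fixes x :: real
  assumes "x > 0"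
  shows "x powr (3 / 2) = x * sqrt x"
proof -
  have "x powr (3 / 2) = x powr (1 + 1 / 2)" by simp
  also have "\<dots> = x * sqrt x" using assms by (simp only: powr_add powr_half_sqrt) simp
  finally show ?thesis .
qed

text \<open>Integration of the derivative bound, done as monotonicity of a difference. All averages
  of the Hessian over a segment are handled this way, with no integral of operators.\<close>

lemma real_derivative_le_imp_increment_le:
  fixes \<phi> :: "real \<Rightarrow> real"
  assumes "\<And>t. 0 \<le> t \<Longrightarrow> t \<le> 1 \<Longrightarrow> (\<phi> has_real_derivative \<phi>' t) (at t)"
    and "\<And>t. 0 \<le> t \<Longrightarrow> t \<le> 1 \<Longrightarrow> \<phi>' t \<le> a + b * t + c * t\<^sup>2"
    and "0 \<le> T" "T \<le> 1"
  shows "\<phi> T - \<phi> 0 \<le> a * T + b * T\<^sup>2 / 2 + c * T ^ 3 / 3"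
proof -
  let ?\<psi> = "\<lambda>t. a * t + b * t\<^sup>2 / 2 + c * t ^ 3 / 3 - \<phi> t"
  have "?\<psi> 0 \<le> ?\<psi> T"
  proof (rule DERIV_nonneg_imp_nondecreasing[OF assms(3)])
    fix t assume t: "0 \<le> t" "t \<le> T"
    then have t': "0 \<le> t" "t \<le> 1" using assms by auto
    have "(?\<psi> has_real_derivative (a + b * t + c * t\<^sup>2 - \<phi>' t)) (at t)"
      by (auto intro!: derivative_eq_intros assms(1) t' simp: power2_eq_square)
    moreover have "a + b * t + c * t\<^sup>2 - \<phi>' t \<ge> 0" using assms(2)[OF t'] by simp
    ultimately show "\<exists>y. (?\<psi> has_real_derivative y) (at t) \<and> 0 \<le> y" by blast
  qed
  then show ?thesis by simp
qed

lemma second_derivative_le_imp_taylor_le: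
  fixes \<phi> :: "real \<Rightarrow> real"
  assumes "\<And>t. 0 \<le> t \<Longrightarrow> t \<le> 1 \<Longrightarrow> (\<phi> has_real_derivative \<phi>' t) (at t)"
    and "\<And>t. 0 \<le> t \<Longrightarrow> t \<le> 1 \<Longrightarrow> (\<phi>' has_real_derivative \<phi>'' t) (at t)"
    and "\<And>t. 0 \<le> t \<Longrightarrow> t \<le> 1 \<Longrightarrow> \<phi>'' t \<le> a + b * t"
  shows "\<phi> 1 - \<phi> 0 \<le> \<phi>' 0 + a / 2 + b / 6"
proof -
  have "\<phi>' t \<le> \<phi>' 0 + a * t + b / 2 * t\<^sup>2" if "0 \<le> t" "t \<le> 1" for t
    using real_derivative_le_imp_increment_le[OF assms(2), of a b 0 t] assms(3) that by simp
  from real_derivative_le_imp_increment_le[OF assms(1) this, of 1] show ?thesis by simp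
qed

text \<open>Used contrapositively: a value below \<open>omega_star tbar\<close> forces the argument
  above \<open>1 - tbar\<close>.\<close>

lemma minus_ln_antimono:
  fixes p q :: real
  assumes "0 < q" "q \<le> p" "p \<le> 1"
  shows "p - 1 - ln p \<le> q - 1 - ln q"
proof -
  have "ln q - ln p = ln (q / p)" using assms by (simp add: ln_div)
  also have "\<dots> \<le> q / p - 1" using assms by (intro ln_le_minus_one) auto
  also have "\<dots> \<le> q - p"
  proof -
    have "(p - q) * p \<le> (p - q) * 1" using assms by (intro mult_left_mono) auto
    then show ?thesis using assms by (simp add: field_simps)
  qed
  finally show ?thesis by linarith
qed

text \<open>With \<open>q = exp s\<close> this is \<open>s \<le> sinh s\<close>; the derivative of
  the difference of the two sides is half a square.\<close>

lemma ln_le_sinh_form: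
  fixes q :: real
  assumes "q \<ge> 1"
  shows "ln q \<le> (q - 1 / q) / 2"
proof -
  let ?\<psi> = "\<lambda>q::real. (q - 1 / q) / 2 - ln q"
  have "?\<psi> 1 \<le> ?\<psi> q"
  proof (rule DERIV_nonneg_imp_nondecreasing[OF assms])
    fix t :: real assume "1 \<le> t"
    then have "(?\<psi> has_real_derivative ((1 + 1 / t\<^sup>2) / 2 - 1 / t)) (at t)"
      by (auto intro!: derivative_eq_intros simp: power2_eq_square field_simps)
    moreover have "(1 + 1 / t\<^sup>2) / 2 - 1 / t = (1 - 1 / t)\<^sup>2 / 2"
      by (simp add: power2_diff power_one_over field_simps)
    then have "(1 + 1 / t\<^sup>2) / 2 - 1 / t \<ge> 0" by (simp only:) simp
    ultimately show "\<exists>y. (?\<psi> has_real_derivative y) (at t) \<and> 0 \<le> y" by blast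
  qed
  then show ?thesis by simp
qed

lemma minus_ln_one_minus_ge:
  fixes \<tau> :: real
  assumes "0 \<le> \<tau>" "\<tau> < 1"
  shows "\<tau> + \<tau>\<^sup>2 / 2 + \<tau> ^ 3 / 3 \<le> - ln (1 - \<tau>)"
proof -
  let ?\<psi> = "\<lambda>t::real. - ln (1 - t) - t - t\<^sup>2 / 2 - t ^ 3 / 3"
  have "?\<psi> 0 \<le> ?\<psi> \<tau>"
  proof (rule DERIV_nonneg_imp_nondecreasing[OF assms(1)])
    fix t :: real assume t: "0 \<le> t" "t \<le> \<tau>"
    with assms have t1: "t < 1" by simp
    then have "(?\<psi> has_real_derivative (1 / (1 - t) - 1 - t - t\<^sup>2)) (at t)"
      by (auto intro!: derivative_eq_intros simp: power2_eq_square)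
    moreover have "1 / (1 - t) - 1 - t - t\<^sup>2 = t ^ 3 / (1 - t)"
      using t1 by (simp add: field_simps power2_eq_square power3_eq_cube)
    then have "1 / (1 - t) - 1 - t - t\<^sup>2 \<ge> 0" using t t1 by simp
    ultimately show "\<exists>y. (?\<psi> has_real_derivative y) (at t) \<and> 0 \<le> y" by blast
  qed
  then show ?thesis by simp
qed

text \<open>
  With \<open>q = \<langle>G d, d\<rangle> / \<langle>A d, d\<rangle>\<close> and \<open>p = \<langle>G d, inv A (G d)\<rangle> / \<langle>G d, d\<rangle>\<close>, the left hand side is the
  squared relative error of \<open>d\<close> as an approximation of the Newton direction \<open>inv A (G d)\<close>.
\<close>

lemma direction_error_le_decrease:
  fixes p q :: real
  assumes q: "q \<ge> 0.55" and p: "p \<ge> q"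
  defines "\<Delta> \<equiv> p - 1 - ln q"
  shows "q * p - 2 * q + 1 \<le> 6 * \<Delta> * (q * p)"
proof -
  have \<Delta>: "\<Delta> \<ge> q - 1 - ln q" using p by (simp add: \<Delta>_def)
  have \<Delta>0: "\<Delta> \<ge> 0" using \<Delta> q ln_le_minus_one[of q] by simp
  \<comment> \<open>This is the claim with \<open>p\<close> replaced by \<open>q + \<Delta>\<close>,
    its largest possible value, since \<open>ln q \<le> q - 1\<close>.\<close>
  have key: "(q - 1)\<^sup>2 + q * \<Delta> \<le> 6 * \<Delta> * (q * (q + \<Delta>))"
  proof (cases "q \<ge> 1")
    case True
    have "q * (2 * ln q) \<le> q * (q - 1 / q)"
      using ln_le_sinh_form[OF True] True by (intro mult_left_mono) auto
    also have "\<dots> = q * q - 1" using True by (simp add: field_simps)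
    finally have "(q - 1)\<^sup>2 \<le> 2 * (q * (q - 1 - ln q))"
      by (simp add: power2_eq_square algebra_simps)
    also have "\<dots> \<le> 2 * (q * \<Delta>)" using \<Delta> True by (intro mult_left_mono) auto
    finally have "(q - 1)\<^sup>2 \<le> 2 * (q * \<Delta>)" .
    moreover have "0 \<le> q * \<Delta>" using \<Delta>0 True by simp
    ultimately have "(q - 1)\<^sup>2 + q * \<Delta> \<le> 6 * (q * \<Delta>) * 1" by linarith
    also have "\<dots> \<le> 6 * (q * \<Delta>) * (q + \<Delta>)" using True \<Delta>0 by (intro mult_left_mono) auto
    finally show ?thesis by (simp add: mult_ac)
  next
    case False
    define \<tau> where "\<tau> = 1 - q"
    have \<tau>: "0 \<le> \<tau>" "\<tau> \<le> 0.45" using False q by (auto simp: \<tau>_def)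
    \<comment> \<open>The coefficient comes from keeping the cubic term of the logarithm series.
      After division by the square of \<open>\<tau>\<close>, the quadratic term alone would give
      only about 0.80 where 1 is needed at \<open>\<tau> = 0.45\<close>.\<close>
    define a where "a = 1 / 2 + \<tau> / 3"
    have a: "a * \<tau>\<^sup>2 \<le> \<Delta>" "a \<ge> 0" "a \<ge> 1 / 2"
      using minus_ln_one_minus_ge[of \<tau>] \<tau> \<Delta>
      by (auto simp: a_def \<tau>_def[symmetric] power2_eq_square power3_eq_cube algebra_simps) (simp add: \<tau>_def)
    have "1 \<le> (1 / 2 - 0.45 / 6 - 0.45 * 0.45 / 3) * (5 - 6 * 0.45 + 3 * (0.45 * 0.45) :: real)" by simp
    also have "\<dots> \<le> (a * (1 - \<tau>)) * (5 - 6 * \<tau> + 6 * (a * \<tau>\<^sup>2))"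
    proof (rule mult_mono)
      have "\<tau> * \<tau> \<le> 0.45 * 0.45" using \<tau> by (intro mult_mono) auto
      then show "1 / 2 - 0.45 / 6 - 0.45 * 0.45 / 3 \<le> a * (1 - \<tau>)"
        using \<tau> by (simp add: a_def field_simps)
      have "3 * (\<tau> * \<tau>) \<le> 6 * (a * \<tau>\<^sup>2)"
        using mult_right_mono[OF a(3), of "\<tau> * \<tau>"] by (simp add: power2_eq_square mult_ac)
      moreover have "(0.45 - \<tau>) * (6 - 3 * (0.45 + \<tau>)) \<ge> 0" using \<tau> by (intro mult_nonneg_nonneg) auto
      then have "5 - 6 * 0.45 + 3 * (0.45 * 0.45) \<le> 5 - 6 * \<tau> + 3 * (\<tau> * \<tau>)"
        by (simp add: field_simps)
      ultimately show "5 - 6 * 0.45 + 3 * (0.45 * 0.45) \<le> 5 - 6 * \<tau> + 6 * (a * \<tau>\<^sup>2)" by linarith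
    qed (use \<tau> a in auto)
    finally have one: "1 \<le> a * (1 - \<tau>) * (5 - 6 * \<tau> + 6 * (a * \<tau>\<^sup>2))" .
    have "\<tau>\<^sup>2 * 1 \<le> \<tau>\<^sup>2 * (a * (1 - \<tau>) * (5 - 6 * \<tau> + 6 * (a * \<tau>\<^sup>2)))"
      by (rule mult_left_mono[OF one]) simp
    also have "\<dots> = (a * \<tau>\<^sup>2) * ((1 - \<tau>) * (5 - 6 * \<tau> + 6 * (a * \<tau>\<^sup>2)))" by (simp add: mult_ac)
    also have "\<dots> \<le> \<Delta> * ((1 - \<tau>) * (5 - 6 * \<tau> + 6 * \<Delta>))"
      using a \<tau> \<Delta>0 by (intro mult_mono mult_left_mono mult_nonneg_nonneg) auto
    finally show ?thesis
      by (simp add: \<tau>_def power2_eq_square algebra_simps)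
  qed
  have pq: "p \<le> q + \<Delta>" using ln_le_minus_one[of q] q by (simp add: \<Delta>_def)
  have "q > 0" using q by simp
  then have q0: "q > 0" "q + \<Delta> > 0" "p > 0" using p \<Delta>0 by linarith+
  \<comment> \<open>For \<open>6 * \<Delta> < 1\<close> the coefficient of \<open>q * p\<close> in
    the difference is positive, so the largest \<open>p\<close> is the worst case. Otherwise
    \<open>2 * q \<ge> 1\<close> suffices.\<close>
  show ?thesis
  proof (cases "6 * \<Delta> \<ge> 1")
    case True
    have "q * p \<le> 6 * \<Delta> * (q * p)" using mult_right_mono[OF True, of "q * p"] q0 by (simp only: mult_1) simp
    moreover have "1 \<le> 2 * q" using q by simp
    ultimately show ?thesis by linarith
  next
    case False
    have "(1 - 6 * \<Delta>) * (q * p) \<le> (1 - 6 * \<Delta>) * (q * (q + \<Delta>))"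
      using False pq q0 by (intro mult_left_mono) auto
    with key show ?thesis by (simp add: power2_eq_square algebra_simps)
  qed
qed

text \<open>The constants 0.03 and 1.03 come from \<open>rho \<le> 0.06\<close>, and 1.0205 from
  passing between \<open>\<sigma>\<close> and \<open>r\<close>. In \<open>s = \<Delta> / D\<close>
  the root is concave and lies below a line, the exponential is convex and lies above one, and the
  two lines are compared.\<close>

lemma contraction_factor_le:
  fixes \<Delta> D :: real
  assumes \<Delta>: "0 \<le> \<Delta>" "\<Delta> \<le> D" and D: "0 < D" "D \<le> 0.10325"
  shows "1.0205 * (0.03 + 1.03 * sqrt (6 * \<Delta>)) \<le> exp (- 0.85 * (1 - \<Delta> / D))"
proof -
  define s where "s = \<Delta> / D"
  have s: "0 \<le> s" "s \<le> 1" using \<Delta> D by (auto simp: s_def)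
  have "6 * \<Delta> = 6 * D * s" using D by (simp add: s_def)
  also have "\<dots> \<le> 0.62 * s" using D s by (intro mult_right_mono) auto
  finally have "6 * \<Delta> \<le> 0.62 * s" .
  \<comment> \<open>The line is nearly tangent to the root of \<open>0.62 * s\<close>, because
    \<open>4 * 0.509 * 0.305\<close> is just above 0.62; in turn 0.62 is \<open>6 * 0.10325\<close>
    rounded up.\<close>
  moreover have "0 \<le> (0.509 * s - 0.305)\<^sup>2" by simp
  then have "0.62 * s \<le> (0.509 * s + 0.305)\<^sup>2"
    using s by (simp add: power2_eq_square algebra_simps)
  ultimately have "sqrt (6 * \<Delta>) \<le> 0.509 * s + 0.305"
    using s by (intro real_le_lsqrt) auto
  then have "1.0205 * (0.03 + 1.03 * sqrt (6 * \<Delta>)) \<le> 1.0205 * (0.03 + 1.03 * (0.509 * s + 0.305))"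
    by (intro mult_left_mono add_left_mono) auto
  also have "\<dots> \<le> 0.638 * (1 + 0.85 * (s - 0.5))"
    using s by (simp add: field_simps)
  also have "\<dots> \<le> exp (- 0.425) * exp (0.85 * (s - 0.5))"
  proof (intro mult_mono)
    \<comment> \<open>Applying \<open>1 + x \<le> exp x\<close> to a quarter of the exponent and
      taking the fourth power is sharp enough.\<close>
    have "(0.638::real) \<le> 0.89375 ^ 4" by (simp add: power4_eq_xxxx)
    also have "\<dots> \<le> exp (- 0.10625) ^ 4"
      using exp_ge_add_one_self[of "- 0.10625 :: real"] by (intro power_mono) auto
    also have "\<dots> = exp (- 0.425)" by (simp flip: exp_of_nat_mult)
    finally show "0.638 \<le> exp (- 0.425 :: real)" .
    show "1 + 0.85 * (s - 0.5) \<le> exp (0.85 * (s - 0.5))" by (rule exp_ge_add_one_self)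
  qed (use s in \<open>auto simp: field_simps\<close>)
  also have "\<dots> = exp (- 0.85 * (1 - s))" by (simp add: field_simps flip: exp_add)
  finally show ?thesis by (simp add: s_def)
qed

text \<open>0.45 bounds \<open>tbar\<close>. The upper bound 0.15 yields a lower bound for
  \<open>\<Upsilon>\<close>, hence the upper bound for \<open>D\<close> that the contraction
  estimate requires.\<close>

lemma omega_star_le:
  assumes "0 < \<tau>" "\<tau> \<le> 0.45"
  shows "0 < omega_star \<tau>" "omega_star \<tau> \<le> 0.15"
proof -
  show "0 < omega_star \<tau>"
  proof -
    have "0 < \<tau>\<^sup>2" using assms by simp
    moreover have "0 < \<tau> ^ 3" using assms by simp
    moreover have "\<tau> + \<tau>\<^sup>2 / 2 + \<tau> ^ 3 / 3 \<le> - ln (1 - \<tau>)"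
      by (rule minus_ln_one_minus_ge) (use assms in auto)
    ultimately show ?thesis unfolding omega_star_def by linarith
  qed
  have "omega_star \<tau> = (1 - \<tau>) - 1 - ln (1 - \<tau>)" by (simp add: omega_star_def)
  also have "\<dots> \<le> 0.55 - 1 - ln 0.55" by (rule minus_ln_antimono) (use assms in auto)
  also have "- ln (0.55 :: real) \<le> 0.6"
  proof -
    have "1 / 0.55 \<le> (1.16125 :: real) ^ 4" by (simp add: power4_eq_xxxx)
    also have "\<dots> \<le> exp 0.15 ^ 4"
      using exp_lower_Taylor_quadratic[of "0.15 :: real"] by (intro power_mono) (auto simp: power2_eq_square)
    also have "\<dots> = exp (0.6 :: real)" by (simp flip: exp_of_nat_mult)
    finally have "ln (1 / 0.55 :: real) \<le> ln (exp 0.6)" by (subst ln_le_cancel_iff) auto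
    then show ?thesis by (simp add: ln_div)
  qed
  then have "(0.55 :: real) - 1 - ln 0.55 \<le> 0.15" by simp
  finally show "omega_star \<tau> \<le> 0.15" .
qed

section \<open>Smooth strongly convex functions near the minimizer\<close>

locale smooth_convex_problem =
  fixes B :: "'a::euclidean_space \<Rightarrow> 'a dual"
    and f :: "'a \<Rightarrow> real"
    and grad :: "'a \<Rightarrow> 'a dual"
    and hess :: "'a \<Rightarrow> 'a \<Rightarrow> 'a dual"
    and \<mu> L2 :: real
    and xs :: 'a
  assumes B: "spd_op B"
    and \<mu>: "\<mu> > 0" and L2: "L2 \<ge> 0"
    and diff: "twice_differentiable_with f grad hess"
    and strongly_convex: "\<And>u v. \<langle>grad u - grad v, u - v\<rangle> \<ge> \<mu> * (primal_norm B (u - v))\<^sup>2"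
    and lipschitz_hess:
      "\<And>u v. operator_norm B (\<lambda>w. hess u w - hess v w) \<le> L2 * primal_norm B (u - v)"
    and minimizer: "\<And>u. f xs \<le> f u"
begin

abbreviation "nB \<equiv> primal_norm B"
abbreviation "A \<equiv> hess xs"
abbreviation "nA \<equiv> primal_norm A"

text \<open>The deviation of \<open>hess y\<close> from \<open>A\<close> relative to
  \<open>A\<close>: each of the two arguments of the Hessian costs \<open>1 / sqrt \<mu>\<close>
  when its \<open>B\<close>-norm is replaced by its \<open>A\<close>-norm. Being a multiple of a
  norm, it is convex along segments.\<close>

definition rho :: "'a \<Rightarrow> real" where "rho y = L2 / \<mu> * nB (y - xs)"

section \<open>Second derivatives along lines, symmetry and lower bound of the Hessian\<close>

lemma linear_hess: "linear (hess y)"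
  using diff unfolding twice_differentiable_with_def by (metis has_derivative_linear)

lemma line_derivative:
  "((\<lambda>t. f (y + t *\<^sub>R d)) has_real_derivative \<langle>grad (y + t *\<^sub>R d), d\<rangle>) (at t)"
proof -
  have "(f has_derivative blinfun_apply (grad (y + t *\<^sub>R d))) (at (y + t *\<^sub>R d))"
    using diff unfolding twice_differentiable_with_def by blast
  moreover have "((\<lambda>t. y + t *\<^sub>R d) has_derivative (\<lambda>s. s *\<^sub>R d)) (at t)"
    by (auto intro!: derivative_eq_intros)
  ultimately have "((\<lambda>t. f (y + t *\<^sub>R d)) has_derivative (\<lambda>s. \<langle>grad (y + t *\<^sub>R d), s *\<^sub>R d\<rangle>)) (at t)"
    using diff_chain_at[of "\<lambda>t. y + t *\<^sub>R d" "\<lambda>s. s *\<^sub>R d" t f] by (simp add: o_def)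
  then show ?thesis
    unfolding has_field_derivative_def
    by (rule has_derivative_eq_rhs) (auto simp: blinfun.scaleR_right)
qed

lemma line_second_derivative:
  "((\<lambda>t. \<langle>grad (y + t *\<^sub>R d), w\<rangle>) has_real_derivative \<langle>hess (y + t *\<^sub>R d) d, w\<rangle>) (at t)"
proof -
  have "(grad has_derivative hess (y + t *\<^sub>R d)) (at (y + t *\<^sub>R d))"
    using diff unfolding twice_differentiable_with_def by blast
  moreover have "((\<lambda>t. y + t *\<^sub>R d) has_derivative (\<lambda>s. s *\<^sub>R d)) (at t)"
    by (auto intro!: derivative_eq_intros)
  ultimately have "((\<lambda>t. grad (y + t *\<^sub>R d)) has_derivative (\<lambda>s. hess (y + t *\<^sub>R d) (s *\<^sub>R d))) (at t)"
    using diff_chain_at[of "\<lambda>t. y + t *\<^sub>R d" "\<lambda>s. s *\<^sub>R d" t grad] by (simp add: o_def)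
  from bounded_linear.has_derivative[OF blinfun.bounded_linear_left this]
  have "((\<lambda>t. \<langle>grad (y + t *\<^sub>R d), w\<rangle>) has_derivative (\<lambda>s. \<langle>hess (y + t *\<^sub>R d) (s *\<^sub>R d), w\<rangle>)) (at t)" .
  then show ?thesis
    unfolding has_field_derivative_def
    by (rule has_derivative_eq_rhs)
      (auto simp: blinfun.scaleR_left linear_scale[OF linear_hess])
qed

lemma hess_lipschitz:
  "\<bar>\<langle>hess u w, v\<rangle> - \<langle>hess y w, v\<rangle>\<bar> \<le> L2 * nB (u - y) * nB w * nB v"
proof -
  have lin: "linear (\<lambda>w. hess u w - hess y w)"
    by (intro linear_compose_sub linear_hess)
  have "\<bar>\<langle>hess u w - hess y w, v\<rangle>\<bar> \<le> dual_norm B (hess u w - hess y w) * nB v"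
    by (rule abs_pairing_le_dual[OF B])
  also have "\<dots> \<le> operator_norm B (\<lambda>w. hess u w - hess y w) * nB w * nB v"
    by (intro mult_right_mono dual_norm_le_operator_norm[OF B lin] primal_norm_nonneg[OF B])
  also have "\<dots> \<le> L2 * nB (u - y) * nB w * nB v"
    by (intro mult_right_mono lipschitz_hess primal_norm_nonneg[OF B])
  finally show ?thesis by (simp add: blinfun.diff_left)
qed

text \<open>The mean value theorem applied twice, in direction \<open>v\<close> and then in
  direction \<open>w\<close>. The left hand side is symmetric in \<open>v\<close> and
  \<open>w\<close>, while the right hand side remembers the order; this yields symmetry of the
  Hessian.\<close>

lemma second_difference:
  assumes "s > 0"
  obtains \<alpha> \<beta> where "0 < \<alpha>" "\<alpha> < s" "0 < \<beta>" "\<beta> < s"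
    "f (y + s *\<^sub>R v + s *\<^sub>R w) - f (y + s *\<^sub>R v) - f (y + s *\<^sub>R w) + f y
      = s\<^sup>2 * \<langle>hess (y + \<alpha> *\<^sub>R v + \<beta> *\<^sub>R w) w, v\<rangle>"
proof -
  let ?\<phi> = "\<lambda>t. f ((y + s *\<^sub>R w) + t *\<^sub>R v) - f (y + t *\<^sub>R v)"
  let ?\<phi>' = "\<lambda>t. \<langle>grad ((y + s *\<^sub>R w) + t *\<^sub>R v), v\<rangle> - \<langle>grad (y + t *\<^sub>R v), v\<rangle>"
  have "\<exists>\<alpha>>0. \<alpha> < s \<and> ?\<phi> s - ?\<phi> 0 = (s - 0) * ?\<phi>' \<alpha>"
    by (rule MVT2) (auto intro!: derivative_intros line_derivative assms)
  then obtain \<alpha> where \<alpha>: "0 < \<alpha>" "\<alpha> < s" "?\<phi> s - ?\<phi> 0 = s * ?\<phi>' \<alpha>" by auto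
  let ?\<psi> = "\<lambda>t. \<langle>grad ((y + \<alpha> *\<^sub>R v) + t *\<^sub>R w), v\<rangle>"
  have "\<exists>\<beta>>0. \<beta> < s \<and> ?\<psi> s - ?\<psi> 0 = (s - 0) * \<langle>hess ((y + \<alpha> *\<^sub>R v) + \<beta> *\<^sub>R w) w, v\<rangle>"
    by (rule MVT2) (auto intro!: line_second_derivative assms)
  then obtain \<beta> where \<beta>: "0 < \<beta>" "\<beta> < s" "?\<psi> s - ?\<psi> 0 = s * \<langle>hess (y + \<alpha> *\<^sub>R v + \<beta> *\<^sub>R w) w, v\<rangle>"
    by auto
  have "?\<phi>' \<alpha> = ?\<psi> s - ?\<psi> 0" by (simp add: add_ac)
  then have "?\<phi> s - ?\<phi> 0 = s\<^sup>2 * \<langle>hess (y + \<alpha> *\<^sub>R v + \<beta> *\<^sub>R w) w, v\<rangle>"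
    using \<alpha>(3) \<beta>(3) by (simp add: power2_eq_square)
  then show ?thesis using that[OF \<alpha>(1,2) \<beta>(1,2)] by (simp add: add_ac)
qed

lemma hess_symmetric: "\<langle>hess y v, w\<rangle> = \<langle>hess y w, v\<rangle>"
proof -
  let ?K = "2 * (L2 * (nB v + nB w) * nB w * nB v)"
  note nn = primal_norm_nonneg[OF B]
  have bound: "\<bar>\<langle>hess (y + \<alpha> *\<^sub>R v + \<beta> *\<^sub>R w) p, q\<rangle> - \<langle>hess y p, q\<rangle>\<bar> \<le> s * (L2 * (nB v + nB w) * nB p * nB q)"
    if "0 < \<alpha>" "\<alpha> < s" "0 < \<beta>" "\<beta> < s" for \<alpha> \<beta> s and p q v w :: 'a
  proof -
    have "nB (\<alpha> *\<^sub>R v + \<beta> *\<^sub>R w) \<le> \<alpha> * nB v + \<beta> * nB w"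
      using primal_norm_triangle[OF B, of "\<alpha> *\<^sub>R v" "\<beta> *\<^sub>R w"] that
      by (simp add: primal_norm_scaleR[OF B])
    also have "\<dots> \<le> s * nB v + s * nB w" using that by (intro add_mono mult_right_mono nn) auto
    finally have "L2 * nB (\<alpha> *\<^sub>R v + \<beta> *\<^sub>R w) * nB p * nB q \<le> L2 * (s * nB v + s * nB w) * nB p * nB q"
      by (intro mult_right_mono mult_left_mono nn L2)
    then show ?thesis
      using hess_lipschitz[of "y + \<alpha> *\<^sub>R v + \<beta> *\<^sub>R w" p q y] by (simp add: algebra_simps)
  qed
  have *: "\<bar>\<langle>hess y v, w\<rangle> - \<langle>hess y w, v\<rangle>\<bar> \<le> s * ?K" if "s > 0" for s
  proof -
    obtain \<alpha> \<beta> where 1: "0 < \<alpha>" "\<alpha> < s" "0 < \<beta>" "\<beta> < s"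
      "f (y + s *\<^sub>R v + s *\<^sub>R w) - f (y + s *\<^sub>R v) - f (y + s *\<^sub>R w) + f y
        = s\<^sup>2 * \<langle>hess (y + \<alpha> *\<^sub>R v + \<beta> *\<^sub>R w) w, v\<rangle>"
      using second_difference[OF \<open>s > 0\<close>] .
    obtain \<alpha>' \<beta>' where 2: "0 < \<alpha>'" "\<alpha>' < s" "0 < \<beta>'" "\<beta>' < s"
      "f (y + s *\<^sub>R w + s *\<^sub>R v) - f (y + s *\<^sub>R w) - f (y + s *\<^sub>R v) + f y
        = s\<^sup>2 * \<langle>hess (y + \<alpha>' *\<^sub>R w + \<beta>' *\<^sub>R v) v, w\<rangle>"
      using second_difference[OF \<open>s > 0\<close>] .
    have "y + s *\<^sub>R w + s *\<^sub>R v = y + s *\<^sub>R v + s *\<^sub>R w" by (simp add: add_ac)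
    then have "s\<^sup>2 * \<langle>hess (y + \<alpha> *\<^sub>R v + \<beta> *\<^sub>R w) w, v\<rangle> = s\<^sup>2 * \<langle>hess (y + \<alpha>' *\<^sub>R w + \<beta>' *\<^sub>R v) v, w\<rangle>"
      using 1(5) 2(5) by (metis (no_types) add.commute diff_diff_eq)
    then have "\<langle>hess (y + \<alpha> *\<^sub>R v + \<beta> *\<^sub>R w) w, v\<rangle> = \<langle>hess (y + \<alpha>' *\<^sub>R w + \<beta>' *\<^sub>R v) v, w\<rangle>"
      using \<open>s > 0\<close> by simp
    then show ?thesis
      using bound[OF 1(1-4), of v w w v] bound[OF 2(1-4), of w v v w] by (simp add: algebra_simps)
  qed
  have "\<bar>\<langle>hess y v, w\<rangle> - \<langle>hess y w, v\<rangle>\<bar> \<le> 0"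
  proof (rule field_le_epsilon)
    fix e :: real assume e: "e > 0"
    have K: "?K \<ge> 0" using L2 nn by simp
    have "e / (?K + 1) * ?K \<le> e" using e K by (simp add: field_simps)
    moreover have "e / (?K + 1) > 0" by (rule divide_pos_pos[OF e]) (use K in linarith)
    ultimately show "\<bar>\<langle>hess y v, w\<rangle> - \<langle>hess y w, v\<rangle>\<bar> \<le> 0 + e" using *[of "e / (?K + 1)"] by linarith
  qed
  then show ?thesis by simp
qed

text \<open>If it failed, \<open>?\<phi>\<close> would drop strictly to the right of 0, whereas
  strong monotonicity of the gradient keeps it at or above its value at 0.\<close>

lemma hess_lower_bound: "\<langle>hess y w, w\<rangle> \<ge> \<mu> * (nB w)\<^sup>2"
proof (rule ccontr)
  let ?\<phi> = "\<lambda>t. \<langle>grad (y + t *\<^sub>R w), w\<rangle> - t * (\<mu> * (nB w)\<^sup>2)"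
  assume "\<not> ?thesis"
  then have neg: "\<langle>hess (y + 0 *\<^sub>R w) w, w\<rangle> - \<mu> * (nB w)\<^sup>2 < 0" by simp
  have "(?\<phi> has_real_derivative (\<langle>hess (y + 0 *\<^sub>R w) w, w\<rangle> - \<mu> * (nB w)\<^sup>2)) (at 0)"
    using line_second_derivative[of y w w 0] by (auto intro!: derivative_eq_intros)
  from DERIV_neg_dec_right[OF this neg] obtain e where
    e: "e > 0" "\<And>h. 0 < h \<Longrightarrow> h < e \<Longrightarrow> ?\<phi> (0 + h) < ?\<phi> 0" by blast
  have "?\<phi> (e / 2) < ?\<phi> 0" using e(1) e(2)[of "e / 2"] by simp
  moreover have "\<mu> * (e / 2)\<^sup>2 * (nB w)\<^sup>2 \<le> (e / 2) * (\<langle>grad (y + (e / 2) *\<^sub>R w), w\<rangle> - \<langle>grad y, w\<rangle>)"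
    using strongly_convex[of "y + (e / 2) *\<^sub>R w" y] e(1)
    by (simp add: primal_norm_scaleR[OF B] blinfun.scaleR_right blinfun.diff_left power_mult_distrib
        power_divide mult_ac)
  then have "(e / 2) * (\<mu> * (e / 2) * (nB w)\<^sup>2) \<le> (e / 2) * (\<langle>grad (y + (e / 2) *\<^sub>R w), w\<rangle> - \<langle>grad y, w\<rangle>)"
    by (simp add: power2_eq_square algebra_simps)
  then have "\<mu> * (e / 2) * (nB w)\<^sup>2 \<le> \<langle>grad (y + (e / 2) *\<^sub>R w), w\<rangle> - \<langle>grad y, w\<rangle>"
    by (rule mult_left_le_imp_le) (use e(1) in simp)
  ultimately show False by (simp add: algebra_simps)
qed

lemma spd_hess: "spd_op (hess y)"
  unfolding spd_op_def
proof (intro conjI allI impI linear_hess hess_symmetric)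
  fix u :: 'a assume "u \<noteq> 0"
  then have "nB u > 0"
    using primal_norm_eq_0[OF B] primal_norm_nonneg[OF B] by (metis order_le_less)
  then show "\<langle>hess y u, u\<rangle> > 0"
    using hess_lower_bound[of u y] \<mu> by (smt (verit) mult_pos_pos zero_less_power)
qed

lemmas nB_nonneg = primal_norm_nonneg[OF B]
lemmas nA_nonneg = primal_norm_nonneg[OF spd_hess, of xs]
lemmas nA_power2 = primal_norm_power2[OF spd_hess, of xs]

section \<open>Deviation of the Hessian, gradient and residual from their quadratic model\<close>

lemma rho_nonneg: "rho y \<ge> 0"
  using \<mu> L2 nB_nonneg by (simp add: rho_def)

lemma rho_segment:
  assumes "0 \<le> t" "t \<le> 1"
  shows "rho (y + t *\<^sub>R (z - y)) \<le> (1 - t) * rho y + t * rho z"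
proof -
  have eq: "y + t *\<^sub>R (z - y) - xs = (1 - t) *\<^sub>R (y - xs) + t *\<^sub>R (z - xs)"
    by (simp add: algebra_simps)
  have "nB (y + t *\<^sub>R (z - y) - xs) \<le> (1 - t) * nB (y - xs) + t * nB (z - xs)"
    unfolding eq using primal_norm_triangle[OF B, of "(1 - t) *\<^sub>R (y - xs)" "t *\<^sub>R (z - xs)"] assms
    by (simp add: primal_norm_scaleR[OF B])
  then have scaled: "c * nB (y + t *\<^sub>R (z - y) - xs) \<le> (1 - t) * (c * nB (y - xs)) + t * (c * nB (z - xs))"
    if "c \<ge> 0" for c
    using mult_left_mono[OF \<open>nB (y + t *\<^sub>R (z - y) - xs) \<le> _\<close> that]
    by (simp only: distrib_left mult.left_commute[of c])
  show ?thesis unfolding rho_def by (rule scaled) (use \<mu> L2 in simp)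
qed

lemma rho_xs: "rho xs = 0"
  by (simp add: rho_def primal_norm_eq_0[OF B, THEN iffD2])

lemma nB_le_nA: "nB w \<le> nA w / sqrt \<mu>"
proof -
  have "\<mu> * (nB w)\<^sup>2 \<le> (nA w)\<^sup>2" using hess_lower_bound[of w xs] by (simp add: nA_power2)
  then have "(sqrt \<mu> * nB w)\<^sup>2 \<le> (nA w)\<^sup>2" using \<mu> by (simp add: power_mult_distrib)
  then have "sqrt \<mu> * nB w \<le> nA w" by (rule power2_le_imp_le) (rule nA_nonneg)
  then show ?thesis using \<mu> by (simp add: field_simps)
qed

lemma hess_deviation: "\<bar>\<langle>hess y w, v\<rangle> - \<langle>A w, v\<rangle>\<bar> \<le> rho y * nA w * nA v"
proof -
  have "nB w * nB v \<le> (nA w / sqrt \<mu>) * (nA v / sqrt \<mu>)"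
    by (intro mult_mono nB_le_nA nB_nonneg) (use \<mu> nA_nonneg in simp)
  also have "\<dots> = nA w * nA v / \<mu>" using \<mu> by (simp add: power2_eq_square[symmetric])
  finally have "L2 * nB (y - xs) * (nB w * nB v) \<le> L2 * nB (y - xs) * (nA w * nA v / \<mu>)"
    by (intro mult_left_mono) (simp_all add: L2 nB_nonneg)
  then show ?thesis
    using hess_lipschitz[of y w v xs] by (simp add: rho_def mult_ac)
qed

lemma hess_deviation_diagonal: "\<bar>\<langle>hess y w, w\<rangle> - \<langle>A w, w\<rangle>\<bar> \<le> rho y * \<langle>A w, w\<rangle>"
  using hess_deviation[of y w w] by (simp only: mult.assoc power2_eq_square[symmetric] nA_power2)

lemma hess_upper: "\<langle>hess y w, w\<rangle> \<le> (1 + rho y) * \<langle>A w, w\<rangle>"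
  using hess_deviation_diagonal[of y w] by (simp add: algebra_simps)

text \<open>The deviation is measured against \<open>hess y\<close>, which has the lower bound
  \<open>\<mu>\<close> itself. Inverting the bound relative to \<open>A\<close> would give
  \<open>1 / (1 - rho y)\<close> and require \<open>rho y < 1\<close>.\<close>

lemma hess_lower: "\<langle>A w, w\<rangle> \<le> (1 + rho y) * \<langle>hess y w, w\<rangle>"
proof -
  have "L2 * nB (y - xs) * nB w * nB w = rho y * (\<mu> * (nB w)\<^sup>2)"
    using \<mu> by (simp add: rho_def power2_eq_square)
  also have "\<dots> \<le> rho y * \<langle>hess y w, w\<rangle>"
    by (intro mult_left_mono hess_lower_bound rho_nonneg)
  finally show ?thesis
    using hess_lipschitz[of y w w xs] by (simp add: algebra_simps)
qed

lemma grad_xs: "grad xs = 0"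
proof (rule blinfun_eqI)
  fix w
  have "((\<lambda>t. f (xs + t *\<^sub>R w)) has_real_derivative \<langle>grad (xs + 0 *\<^sub>R w), w\<rangle>) (at 0)"
    by (rule line_derivative)
  then have "\<langle>grad (xs + 0 *\<^sub>R w), w\<rangle> = 0"
    by (rule DERIV_local_min[where d = 1]) (auto simp: minimizer)
  then show "\<langle>grad xs, w\<rangle> = \<langle>0, w\<rangle>" by simp
qed

lemma quadratic_growth: "\<mu> / 2 * (nB (y - xs))\<^sup>2 \<le> f y - f xs"
proof -
  let ?u = "y - xs"
  have *: "- \<langle>grad (xs + t *\<^sub>R ?u), ?u\<rangle> \<le> - (\<mu> * (nB ?u)\<^sup>2) * t" if "0 \<le> t" "t \<le> 1" for t
  proof (cases "t = 0")
    case False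
    have "t * (\<mu> * (nB ?u)\<^sup>2 * t) \<le> t * \<langle>grad (xs + t *\<^sub>R ?u), ?u\<rangle>"
      using strongly_convex[of "xs + t *\<^sub>R ?u" xs] that
      by (simp add: grad_xs primal_norm_scaleR[OF B] blinfun.scaleR_right power_mult_distrib
          power2_eq_square mult_ac)
    then have "\<mu> * (nB ?u)\<^sup>2 * t \<le> \<langle>grad (xs + t *\<^sub>R ?u), ?u\<rangle>"
      by (rule mult_left_le_imp_le) (use False that in simp)
    then show ?thesis by simp
  qed (simp add: grad_xs)
  have "- f (xs + 1 *\<^sub>R ?u) - - f (xs + 0 *\<^sub>R ?u) \<le> 0 * 1 + - (\<mu> * (nB ?u)\<^sup>2) * 1\<^sup>2 / 2 + 0 * 1 ^ 3 / 3"
    by (rule real_derivative_le_imp_increment_le[where \<phi>' = "\<lambda>t. - \<langle>grad (xs + t *\<^sub>R ?u), ?u\<rangle>"])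
      (use * in \<open>auto intro!: derivative_intros line_derivative\<close>)
  then show ?thesis by simp
qed

text \<open>The origin of the constant \<open>Hc\<close>: quadratic growth contributes
  \<open>sqrt (2 / \<mu>)\<close> and the definition of \<open>rho\<close> contributes
  \<open>L2 / \<mu>\<close>.\<close>

lemma rho_le_residual: "rho y \<le> sqrt 2 * L2 / \<mu> powr (3 / 2) * sqrt (f y - f xs)"
proof -
  have "(nB (y - xs))\<^sup>2 \<le> 2 / \<mu> * (f y - f xs)"
    using quadratic_growth[of y] \<mu> by (simp add: field_simps)
  then have "nB (y - xs) \<le> sqrt (2 / \<mu> * (f y - f xs))" by (rule real_le_rsqrt)
  then have "rho y \<le> L2 / \<mu> * sqrt (2 / \<mu> * (f y - f xs))"
    unfolding rho_def using \<mu> L2 by (intro mult_left_mono) auto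
  also have "\<dots> = sqrt 2 * L2 / \<mu> powr (3 / 2) * sqrt (f y - f xs)"
    unfolding powr_three_halves[OF \<mu>] real_sqrt_mult real_sqrt_divide by simp
  finally show ?thesis .
qed

text \<open>On the segment from \<open>xs\<close> to \<open>y\<close>, \<open>rho\<close> is at most
  \<open>t * rho y\<close>; integrating once gives the factor 1/2, and integrating twice gives 1/6
  for the residual below.\<close>

lemma gradient_deviation:
  "\<bar>\<langle>grad y - A (y - xs), w\<rangle>\<bar> \<le> rho y / 2 * nA (y - xs) * nA w"
proof -
  let ?u = "y - xs"
  have *: "\<langle>grad y - A ?u, w\<rangle> \<le> rho y / 2 * nA ?u * nA w" for w
  proof -
    let ?\<phi> = "\<lambda>t. \<langle>grad (xs + t *\<^sub>R ?u), w\<rangle> - t * \<langle>A ?u, w\<rangle>"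
    have "?\<phi> 1 - ?\<phi> 0 \<le> 0 * 1 + (rho y * nA ?u * nA w) * 1\<^sup>2 / 2 + 0 * 1 ^ 3 / 3"
    proof (rule real_derivative_le_imp_increment_le)
      fix t :: real assume t: "0 \<le> t" "t \<le> 1"
      show "(?\<phi> has_real_derivative (\<langle>hess (xs + t *\<^sub>R ?u) ?u, w\<rangle> - \<langle>A ?u, w\<rangle>)) (at t)"
        by (auto intro!: derivative_eq_intros line_second_derivative)
      have "rho (xs + t *\<^sub>R ?u) \<le> t * rho y"
        using rho_segment[OF t, of xs y] by (simp add: rho_xs)
      then have "rho (xs + t *\<^sub>R ?u) * nA ?u * nA w \<le> t * rho y * nA ?u * nA w"
        by (intro mult_right_mono nA_nonneg)
      then show "\<langle>hess (xs + t *\<^sub>R ?u) ?u, w\<rangle> - \<langle>A ?u, w\<rangle> \<le> 0 + (rho y * nA ?u * nA w) * t + 0 * t\<^sup>2"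
        using hess_deviation[of "xs + t *\<^sub>R ?u" ?u w] by (simp add: mult_ac)
    qed auto
    then show ?thesis by (simp add: grad_xs blinfun.diff_left)
  qed
  from *[of w] *[of "- w"] show ?thesis
    by (simp add: primal_norm_minus[OF spd_hess] blinfun.minus_right abs_le_iff)
qed

lemma residual_deviation:
  "\<bar>f y - f xs - (nA (y - xs))\<^sup>2 / 2\<bar> \<le> rho y / 6 * (nA (y - xs))\<^sup>2"
proof -
  let ?u = "y - xs"
  have rho: "\<bar>\<langle>hess (xs + t *\<^sub>R ?u) ?u, ?u\<rangle> - (nA ?u)\<^sup>2\<bar> \<le> rho y * (nA ?u)\<^sup>2 * t" if t: "0 \<le> t" "t \<le> 1" for t
  proof -
    have "rho (xs + t *\<^sub>R ?u) \<le> t * rho y"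
      using rho_segment[OF t, of xs y] by (simp add: rho_xs)
    then have "rho (xs + t *\<^sub>R ?u) * (nA ?u)\<^sup>2 \<le> t * rho y * (nA ?u)\<^sup>2"
      by (intro mult_right_mono) auto
    then show ?thesis
      using hess_deviation_diagonal[of "xs + t *\<^sub>R ?u" ?u] by (simp add: nA_power2 mult_ac)
  qed
  have "f (xs + 1 *\<^sub>R ?u) - f (xs + 0 *\<^sub>R ?u) \<le> \<langle>grad (xs + 0 *\<^sub>R ?u), ?u\<rangle> + (nA ?u)\<^sup>2 / 2 + rho y * (nA ?u)\<^sup>2 / 6"
    by (rule second_derivative_le_imp_taylor_le[OF line_derivative line_second_derivative])
      (use rho in \<open>fastforce simp: abs_le_iff\<close>)
  moreover have "- f (xs + 1 *\<^sub>R ?u) - - f (xs + 0 *\<^sub>R ?u)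
      \<le> - \<langle>grad (xs + 0 *\<^sub>R ?u), ?u\<rangle> + - (nA ?u)\<^sup>2 / 2 + rho y * (nA ?u)\<^sup>2 / 6"
    by (rule second_derivative_le_imp_taylor_le[OF DERIV_minus[OF line_derivative] DERIV_minus[OF line_second_derivative]])
      (use rho in \<open>fastforce simp: abs_le_iff\<close>)
  ultimately show ?thesis by (intro abs_leI) (simp_all add: grad_xs)
qed

text \<open>
  Both bounds come from the average Hessian \<open>J\<close> of the segment, for which \<open>\<gamma> = J \<delta>\<close>. The second one
  is \<open>0 \<le> \<langle>J u, u\<rangle>\<close> for \<open>u = \<delta> - (1 / (1 + c)) *\<^sub>R inv A \<gamma>\<close>, integrated along the segment.
\<close>

lemma secant_bounds:
  assumes c: "rho y \<le> c" "rho z \<le> c"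
  defines "\<gamma> \<equiv> grad z - grad y" and "\<delta> \<equiv> z - y"
  shows "\<langle>A \<delta>, \<delta>\<rangle> \<le> (1 + c) * \<langle>\<gamma>, \<delta>\<rangle>" and "\<langle>\<gamma>, inv A \<gamma>\<rangle> \<le> (1 + c) * \<langle>\<gamma>, \<delta>\<rangle>"
proof -
  have c0: "c \<ge> 0" using c rho_nonneg[of y] by linarith
  have rho: "rho (y + t *\<^sub>R \<delta>) \<le> c" if "0 \<le> t" "t \<le> 1" for t
    unfolding \<delta>_def using rho_segment[OF that, of y z] convex_bound_le[OF c, of "1 - t" t] that by simp
  have *: "- (\<langle>grad (y + 1 *\<^sub>R \<delta>), \<delta>\<rangle>) - - \<langle>grad (y + 0 *\<^sub>R \<delta>), \<delta>\<rangle>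
      \<le> (- \<langle>A \<delta>, \<delta>\<rangle> / (1 + c)) * 1 + 0 * 1\<^sup>2 / 2 + 0 * 1 ^ 3 / 3"
  proof (rule real_derivative_le_imp_increment_le[OF DERIV_minus[OF line_second_derivative]])
    fix t :: real assume "0 \<le> t" "t \<le> 1"
    have "\<langle>A \<delta>, \<delta>\<rangle> \<le> (1 + rho (y + t *\<^sub>R \<delta>)) * \<langle>hess (y + t *\<^sub>R \<delta>) \<delta>, \<delta>\<rangle>" by (rule hess_lower)
    also have "\<dots> \<le> (1 + c) * \<langle>hess (y + t *\<^sub>R \<delta>) \<delta>, \<delta>\<rangle>"
      using rho[OF \<open>0 \<le> t\<close> \<open>t \<le> 1\<close>] by (intro mult_right_mono spd_op_nonneg spd_hess) auto
    finally show "- \<langle>hess (y + t *\<^sub>R \<delta>) \<delta>, \<delta>\<rangle> \<le> (- \<langle>A \<delta>, \<delta>\<rangle> / (1 + c)) + 0 * t + 0 * t\<^sup>2"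
      using c0 by (simp add: field_simps)
  qed auto
  then show "\<langle>A \<delta>, \<delta>\<rangle> \<le> (1 + c) * \<langle>\<gamma>, \<delta>\<rangle>"
    using c0 by (simp add: \<gamma>_def \<delta>_def blinfun.diff_left field_simps)
  define w where "w = inv A \<gamma>"
  let ?s = "1 / (1 + c)"
  let ?\<phi> = "\<lambda>t. 2 * ?s * \<langle>grad (y + t *\<^sub>R \<delta>), w\<rangle> - \<langle>grad (y + t *\<^sub>R \<delta>), \<delta>\<rangle>"
  have "?\<phi> 1 - ?\<phi> 0 \<le> (?s * \<langle>A w, w\<rangle>) * 1 + 0 * 1\<^sup>2 / 2 + 0 * 1 ^ 3 / 3"
  proof (rule real_derivative_le_imp_increment_le)
    fix t :: real assume t: "0 \<le> t" "t \<le> 1"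
    let ?h = "hess (y + t *\<^sub>R \<delta>)"
    show "(?\<phi> has_real_derivative (2 * ?s * \<langle>?h \<delta>, w\<rangle> - \<langle>?h \<delta>, \<delta>\<rangle>)) (at t)"
      by (intro derivative_intros DERIV_cmult line_second_derivative)
    have "0 \<le> \<langle>?h (\<delta> - ?s *\<^sub>R w), \<delta> - ?s *\<^sub>R w\<rangle>" by (rule spd_op_nonneg[OF spd_hess])
    then have "2 * ?s * \<langle>?h \<delta>, w\<rangle> - \<langle>?h \<delta>, \<delta>\<rangle> \<le> ?s\<^sup>2 * \<langle>?h w, w\<rangle>"
      unfolding spd_op_expand[OF spd_hess] by simp
    also have "\<dots> \<le> ?s\<^sup>2 * ((1 + c) * \<langle>A w, w\<rangle>)"
    proof (intro mult_left_mono)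
      have "(1 + rho (y + t *\<^sub>R \<delta>)) * \<langle>A w, w\<rangle> \<le> (1 + c) * \<langle>A w, w\<rangle>"
        using rho[OF t] by (intro mult_right_mono spd_op_nonneg spd_hess) auto
      then show "\<langle>?h w, w\<rangle> \<le> (1 + c) * \<langle>A w, w\<rangle>" using hess_upper[of "y + t *\<^sub>R \<delta>" w] by linarith
    qed simp
    also have "\<dots> = ?s * \<langle>A w, w\<rangle>" using c0 by (simp add: power2_eq_square)
    finally show "2 * ?s * \<langle>?h \<delta>, w\<rangle> - \<langle>?h \<delta>, \<delta>\<rangle> \<le> ?s * \<langle>A w, w\<rangle> + 0 * t + 0 * t\<^sup>2" by simp
  qed auto
  then have "2 * ?s * \<langle>\<gamma>, w\<rangle> - \<langle>\<gamma>, \<delta>\<rangle> \<le> ?s * \<langle>A w, w\<rangle>"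
    by (simp add: \<gamma>_def \<delta>_def blinfun.diff_left right_diff_distrib diff_divide_distrib)
  moreover have "\<langle>A w, w\<rangle> = \<langle>\<gamma>, w\<rangle>" by (simp add: w_def spd_op_inv(1)[OF spd_hess])
  ultimately have "?s * \<langle>\<gamma>, w\<rangle> \<le> \<langle>\<gamma>, \<delta>\<rangle>" by simp
  then show "\<langle>\<gamma>, inv A \<gamma>\<rangle> \<le> (1 + c) * \<langle>\<gamma>, \<delta>\<rangle>"
    using c0 by (simp add: w_def field_simps)
qed

text \<open>The replacement of \<open>A \<delta>\<close> by \<open>\<gamma>\<close> costs at most
  \<open>c\<close> in the trace and \<open>ln (1 + c) \<le> c\<close> in the determinant, for any
  size of \<open>c\<close>.\<close>

lemma psi_step:
  assumes G: "spd_op G" and c: "rho y \<le> c" "rho z \<le> c"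
    and pos: "\<langle>grad z - grad y, z - y\<rangle> > 0"
  shows "psi A (bfgs_direct G (z - y) (grad z - grad y)) \<le> psi A G - bfgs_decrease A G (z - y) + 2 * c"
proof -
  let ?\<delta> = "z - y" and ?\<gamma> = "grad z - grad y"
  have c0: "c \<ge> 0" using c rho_nonneg[of y] by linarith
  have "?\<delta> \<noteq> 0" using pos by auto
  then have A\<delta>: "\<langle>A ?\<delta>, ?\<delta>\<rangle> > 0" by (rule spd_opD(3)[OF spd_hess])
  have "\<langle>?\<gamma>, inv A ?\<gamma>\<rangle> / \<langle>?\<gamma>, ?\<delta>\<rangle> \<le> 1 + c"
    using secant_bounds(2)[OF c] pos by (simp add: field_simps)
  moreover have "ln (1 / (1 + c)) \<le> ln (\<langle>?\<gamma>, ?\<delta>\<rangle> / \<langle>A ?\<delta>, ?\<delta>\<rangle>)"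
    using secant_bounds(1)[OF c] pos A\<delta> c0 by (subst ln_le_cancel_iff) (auto simp: field_simps)
  then have "- c \<le> ln (\<langle>?\<gamma>, ?\<delta>\<rangle> / \<langle>A ?\<delta>, ?\<delta>\<rangle>)"
    using ln_add_one_self_le_self[OF c0] c0 by (simp add: ln_div)
  ultimately show ?thesis
    using psi_bfgs_direct[OF spd_hess G pos, of xs] psi_nonneg[OF spd_hess G, of xs] by simp
qed

text \<open>\<open>inv A (grad y)\<close> is the Newton direction at \<open>y\<close> with the Hessian frozen at the solution.\<close>

lemma newton_direction_error: "nA (inv A (grad y) - (y - xs)) \<le> rho y / 2 * nA (y - xs)"
proof -
  let ?v = "inv A (grad y)"
  let ?w = "?v - (y - xs)"
  have "\<langle>grad y - A (y - xs), ?w\<rangle> = \<langle>A ?w, ?w\<rangle>"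
    by (simp add: linear_diff[OF linear_hess] spd_op_inv(1)[OF spd_hess])
  then have "(nA ?w)\<^sup>2 \<le> rho y / 2 * nA (y - xs) * nA ?w"
    using gradient_deviation[of y ?w] by (simp add: nA_power2)
  then have "nA ?w * nA ?w \<le> rho y / 2 * nA (y - xs) * nA ?w" by (simp add: power2_eq_square)
  moreover have "nA ?w = 0 \<Longrightarrow> ?thesis" using rho_nonneg nA_nonneg by simp
  ultimately show ?thesis using nA_nonneg[of ?w] by (cases "nA ?w = 0") (auto simp: mult_le_cancel_right)
qed

lemma newton_direction_norm: "nA (inv A (grad y)) \<le> (1 + rho y / 2) * nA (y - xs)"
  using primal_norm_triangle[OF spd_hess, of xs "inv A (grad y) - (y - xs)" "y - xs"]
    newton_direction_error[of y] by (simp add: algebra_simps)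

text \<open>The new error is split at the Newton direction: \<open>y - xs\<close> differs from it by
  the nonlinearity of the gradient, and \<open>d\<close> differs from it by a relative error of at
  most the root of six times the decrease.\<close>

lemma full_step_contraction:
  assumes G: "spd_op G" and d: "d \<noteq> 0" "G d = grad y"
    and q: "\<langle>G d, d\<rangle> / \<langle>A d, d\<rangle> \<ge> 0.55"
  shows "nA (y - d - xs) \<le> (rho y / 2 + (1 + rho y / 2) * sqrt (6 * bfgs_decrease A G d)) * nA (y - xs)"
proof -
  let ?v = "inv A (grad y)" and ?\<Delta> = "bfgs_decrease A G d"
  have pos: "\<langle>G d, d\<rangle> > 0" "\<langle>A d, d\<rangle> > 0"
    using spd_opD(3)[OF G d(1)] spd_opD(3)[OF spd_hess d(1)] .
  have \<Delta>: "?\<Delta> \<ge> 0" by (rule bfgs_decrease_nonneg[OF spd_hess G d(1)])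
  define q where "q = \<langle>G d, d\<rangle> / \<langle>A d, d\<rangle>"
  define p where "p = \<langle>G d, ?v\<rangle> / \<langle>G d, d\<rangle>"
  have Av: "A ?v = G d" by (simp add: d spd_op_inv(1)[OF spd_hess])
  have "\<langle>G d, d\<rangle>\<^sup>2 \<le> \<langle>G d, ?v\<rangle> * \<langle>A d, d\<rangle>"
    using spd_op_dual_cauchy_schwarz[OF spd_hess, of "G d" d xs] by (simp add: d)
  then have "q \<le> p" using pos by (simp add: q_def p_def field_simps power2_eq_square)
  moreover have "?\<Delta> = p - 1 - ln q" by (simp add: bfgs_decrease_def p_def q_def d)
  ultimately have le: "q * p - 2 * q + 1 \<le> 6 * ?\<Delta> * (q * p)"
    using direction_error_le_decrease[of q p] q by (simp add: q_def)
  have qp: "q * \<langle>A d, d\<rangle> = \<langle>G d, d\<rangle>" "q * p * \<langle>A d, d\<rangle> = \<langle>G d, ?v\<rangle>"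
    using pos by (simp_all add: q_def p_def)
  have "(nA (?v - d))\<^sup>2 = \<langle>A ?v, ?v\<rangle> - 2 * \<langle>A ?v, d\<rangle> + \<langle>A d, d\<rangle>"
    using spd_op_expand[OF spd_hess, of xs ?v 1 d] by (simp add: nA_power2)
  also have "\<dots> = (q * p - 2 * q + 1) * \<langle>A d, d\<rangle>"
    by (simp add: Av qp[symmetric] algebra_simps)
  also have "\<dots> \<le> 6 * ?\<Delta> * (q * p) * \<langle>A d, d\<rangle>"
    using le pos by (intro mult_right_mono) auto
  also have "\<dots> = 6 * ?\<Delta> * (q * p * \<langle>A d, d\<rangle>)" by (simp only: mult.assoc)
  also have "\<dots> = 6 * ?\<Delta> * (nA ?v)\<^sup>2" by (simp only: nA_power2 Av qp(2))
  also have "\<dots> = (sqrt (6 * ?\<Delta>) * nA ?v)\<^sup>2" using \<Delta> by (simp add: power_mult_distrib)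
  finally have "nA (?v - d) \<le> sqrt (6 * ?\<Delta>) * nA ?v"
    by (rule power2_le_imp_le) (use \<Delta> nA_nonneg in simp)
  also have "\<dots> \<le> sqrt (6 * ?\<Delta>) * ((1 + rho y / 2) * nA (y - xs))"
    using \<Delta> by (intro mult_left_mono newton_direction_norm) simp
  finally have 1: "nA (?v - d) \<le> sqrt (6 * ?\<Delta>) * ((1 + rho y / 2) * nA (y - xs))" .
  have "nA (y - d - xs) \<le> nA ((y - xs) - ?v) + nA (?v - d)"
    using primal_norm_triangle[OF spd_hess, of xs "(y - xs) - ?v" "?v - d"] by (simp add: algebra_simps)
  moreover have "nA ((y - xs) - ?v) \<le> rho y / 2 * nA (y - xs)"
    using newton_direction_error[of y] primal_norm_minus[OF spd_hess, of xs "?v - (y - xs)"] by simp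
  ultimately show ?thesis using 1 by (simp add: algebra_simps)
qed

lemma residual_bounds:
  assumes "rho y \<le> 0.06"
  shows "0.49 * (nA (y - xs))\<^sup>2 \<le> f y - f xs" "f y - f xs \<le> 0.51 * (nA (y - xs))\<^sup>2"
proof -
  have "rho y / 6 * (nA (y - xs))\<^sup>2 \<le> 0.01 * (nA (y - xs))\<^sup>2"
    using assms by (intro mult_right_mono) auto
  with residual_deviation[of y]
  have *: "\<bar>f y - f xs - (nA (y - xs))\<^sup>2 / 2\<bar> \<le> 0.01 * (nA (y - xs))\<^sup>2" by (rule order_trans)
  show "0.49 * (nA (y - xs))\<^sup>2 \<le> f y - f xs" "f y - f xs \<le> 0.51 * (nA (y - xs))\<^sup>2"
    using abs_le_D1[OF *] abs_le_D2[OF *] by simp_all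
qed

text \<open>2.873 bounds \<open>1 + 1.03 / 0.55\<close>, the length of a trial error relative to the
  current one. Its square is below \<open>18 * 0.49\<close>, so \<open>rho\<close> at the trial
  point is at most three times the bound at \<open>y\<close>.\<close>

lemma scaled_nA_le_residual:
  assumes "rho y \<le> 0.06"
  shows "L2 / (\<mu> * sqrt \<mu>) * (2.873 * nA (y - xs)) \<le> 3 * (sqrt 2 * L2 / \<mu> powr (3 / 2) * sqrt (f y - f xs))"
proof -
  note * = residual_bounds(1)[OF assms]
  have "(2.873 * nA (y - xs))\<^sup>2 \<le> 18 * (0.49 * (nA (y - xs))\<^sup>2)"
    by (simp add: power_mult_distrib power2_eq_square)
  also have "\<dots> \<le> 18 * (f y - f xs)" using * by simp
  also have "\<dots> = (3 * sqrt 2 * sqrt (f y - f xs))\<^sup>2"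
    using minimizer[of y] by (simp add: power_mult_distrib)
  finally have "2.873 * nA (y - xs) \<le> 3 * sqrt 2 * sqrt (f y - f xs)"
    by (rule power2_le_imp_le) (use minimizer[of y] in simp)
  then have "L2 / (\<mu> * sqrt \<mu>) * (2.873 * nA (y - xs)) \<le> L2 / (\<mu> * sqrt \<mu>) * (3 * sqrt 2 * sqrt (f y - f xs))"
    using L2 \<mu> by (intro mult_left_mono) auto
  then show ?thesis by (simp add: powr_three_halves[OF \<mu>] mult_ac)
qed

text \<open>With \<open>e = 1 - 2 * \<eta>\<close>, acceptance requires
  \<open>(1 + e) * \<langle>grad y, d\<rangle>\<close> to dominate the second order term. The factor
  0.9 in the hypothesis leaves the margin \<open>0.1 * e\<close>, which the Hessian variation uses
  up exactly: \<open>(2 * 0.06 + 0.18) / 3 = 0.1\<close>.\<close>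

lemma armijo_full_step:
  assumes \<eta>: "0 < \<eta>" "\<eta> < 1 / 2"
    and small: "sqrt 2 * L2 / \<mu> powr (3 / 2) * sqrt (f y - f xs) \<le> 0.06 * (1 - 2 * \<eta>)"
    and d: "d \<noteq> 0"
    and q: "\<langle>grad y, d\<rangle> \<ge> (1 - 0.9 * ((1 - 2 * \<eta>) / (2 * (1 - \<eta>)))) * \<langle>A d, d\<rangle>"
  shows "armijo f grad \<eta> y d 0"
proof -
  define e where "e = 1 - 2 * \<eta>"
  have e: "0 < e" "e < 1" "\<eta> = (1 - e) / 2" using \<eta> by (auto simp: e_def)
  let ?dd = "\<langle>A d, d\<rangle>"
  have dd: "?dd > 0" by (rule spd_opD(3)[OF spd_hess d])
  have nAd: "nA d > 0" using dd by (simp add: primal_norm_def)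
  have q': "(1 + e) * \<langle>grad y, d\<rangle> \<ge> (1 + 0.1 * e) * ?dd"
  proof -
    have "(1 + e) * (1 - 0.9 * (e / (1 + e))) = 1 + 0.1 * e" using e by (simp add: field_simps)
    moreover have "2 * (1 - \<eta>) = 1 + e" by (simp add: e_def)
    moreover have "(1 + e) * ((1 - 0.9 * (e / (2 * (1 - \<eta>)))) * ?dd) \<le> (1 + e) * \<langle>grad y, d\<rangle>"
      using mult_left_mono[OF q, of "1 + e"] e(1) by (simp only: e_def[symmetric])
    ultimately show ?thesis by (simp only: mult.assoc[symmetric])
  qed
  have "0.55 * (1 + e) \<le> 1 + 0.1 * e" using e by simp
  then have "(1 + e) * (0.55 * ?dd) \<le> (1 + 0.1 * e) * ?dd"
    using mult_right_mono[of "0.55 * (1 + e)" "1 + 0.1 * e" ?dd] dd by (simp add: mult_ac)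
  then have "(1 + e) * (0.55 * ?dd) \<le> (1 + e) * \<langle>grad y, d\<rangle>" using q' by linarith
  then have q55: "0.55 * ?dd \<le> \<langle>grad y, d\<rangle>" by (rule mult_left_le_imp_le) (use e in simp)
  have rho: "rho y \<le> 0.06 * e" using order_trans[OF rho_le_residual small] by (simp add: e_def)
  then have rho': "rho y \<le> 0.06" using e by simp
  \<comment> \<open>A crude bound on the length of the step keeps the trial point in the region where the Hessian
    is close to \<open>A\<close>.\<close>
  have "0.55 * (nA d * nA d) \<le> nA (inv A (grad y)) * nA d"
    using q55 abs_pairing_le[OF spd_hess, of xs "inv A (grad y)" d] nA_power2[of d]
    by (simp add: spd_op_inv(1)[OF spd_hess] power2_eq_square)
  then have "(0.55 * nA d) * nA d \<le> nA (inv A (grad y)) * nA d" by simp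
  then have "0.55 * nA d \<le> nA (inv A (grad y))" by (rule mult_right_le_imp_le) (rule nAd)
  also have "\<dots> \<le> (1 + rho y / 2) * nA (y - xs)" by (rule newton_direction_norm)
  also have "\<dots> \<le> 1.03 * nA (y - xs)" using rho' by (intro mult_right_mono nA_nonneg) simp
  finally have "nA d \<le> 1.873 * nA (y - xs)" using nA_nonneg[of "y - xs"] by simp
  moreover have "nA (y - d - xs) \<le> nA (y - xs) + nA d"
    using primal_norm_triangle[OF spd_hess, of xs "y - xs" "- d"]
    by (simp add: primal_norm_minus[OF spd_hess] algebra_simps)
  ultimately have "nA (y - d - xs) \<le> 2.873 * nA (y - xs)" by simp
  then have "L2 / (\<mu> * sqrt \<mu>) * nA (y - d - xs) \<le> L2 / (\<mu> * sqrt \<mu>) * (2.873 * nA (y - xs))"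
    using L2 \<mu> by (intro mult_left_mono) auto
  also have "\<dots> \<le> 0.18 * e" using scaled_nA_le_residual[OF rho'] small by (simp add: e_def)
  finally have "L2 / (\<mu> * sqrt \<mu>) * nA (y - d - xs) \<le> 0.18 * e" .
  moreover have "rho (y - d) \<le> L2 / \<mu> * (nA (y - d - xs) / sqrt \<mu>)"
    unfolding rho_def using L2 \<mu> by (intro mult_left_mono nB_le_nA) auto
  then have "rho (y - d) \<le> L2 / (\<mu> * sqrt \<mu>) * nA (y - d - xs)" by simp
  ultimately have rho1: "rho (y - d) \<le> 0.18 * e" by (rule order_trans[rotated])
  have "f (y + 1 *\<^sub>R - d) - f (y + 0 *\<^sub>R - d)
      \<le> \<langle>grad (y + 0 *\<^sub>R - d), - d\<rangle> + ((1 + rho y) * ?dd) / 2 + ((rho (y - d) - rho y) * ?dd) / 6"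
  proof (rule second_derivative_le_imp_taylor_le[OF line_derivative line_second_derivative])
    fix t :: real assume t: "0 \<le> t" "t \<le> 1"
    let ?h = "hess (y + t *\<^sub>R - d)"
    have "\<langle>?h (- d), - d\<rangle> = \<langle>?h d, d\<rangle>"
      by (simp add: linear_neg[OF linear_hess] blinfun.minus_left blinfun.minus_right)
    also have "\<dots> \<le> (1 + rho (y + t *\<^sub>R - d)) * ?dd" by (rule hess_upper)
    also have "\<dots> \<le> (1 + ((1 - t) * rho y + t * rho (y - d))) * ?dd"
      using rho_segment[OF t, of y "y - d"] dd by (intro mult_right_mono) auto
    finally show "\<langle>?h (- d), - d\<rangle> \<le> (1 + rho y) * ?dd + ((rho (y - d) - rho y) * ?dd) * t"
      by (simp add: algebra_simps)
  qed
  then have "f (y - d) - f y \<le> - \<langle>grad y, d\<rangle> + (1 + (2 * rho y + rho (y - d)) / 3) * ?dd / 2"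
    by (simp add: blinfun.minus_right field_simps)
  also have "(1 + (2 * rho y + rho (y - d)) / 3) * ?dd \<le> (1 + 0.1 * e) * ?dd"
    using rho rho1 dd by (intro mult_right_mono) auto
  also have "\<dots> \<le> (1 + e) * \<langle>grad y, d\<rangle>" by (rule q')
  finally have "f (y - d) - f y \<le> - \<langle>grad y, d\<rangle> + (1 + e) * \<langle>grad y, d\<rangle> / 2" by simp
  then show ?thesis by (simp add: armijo_def e(3) field_simps)
qed

text \<open>0.7 is the root of 0.49, and 1.0205 is slightly above the root of
  \<open>0.51 / 0.49\<close>.\<close>

lemma residual_norm_bounds:
  assumes "rho y \<le> 0.06"
  shows "0.7 * nA (y - xs) \<le> sqrt (f y - f xs)" and "sqrt (f y - f xs) \<le> 1.0205 * (0.7 * nA (y - xs))"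
proof -
  note * = residual_bounds[OF assms]
  show "0.7 * nA (y - xs) \<le> sqrt (f y - f xs)"
    using *(1) by (intro real_le_rsqrt) (simp add: power_mult_distrib power2_eq_square)
  have "0.51 * (nA (y - xs))\<^sup>2 \<le> (1.0205 * (0.7 * nA (y - xs)))\<^sup>2"
    by (simp add: power_mult_distrib power2_eq_square)
  with *(2) show "sqrt (f y - f xs) \<le> 1.0205 * (0.7 * nA (y - xs))"
    using nA_nonneg by (intro real_le_lsqrt) (auto simp: minimizer)
qed

end

section \<open>Summable decrease and linear convergence of the iteration\<close>

theorem corollary5p16:
  fixes B :: "'a::euclidean_space \<Rightarrow> 'a dual"
    and f :: "'a \<Rightarrow> real"
    and grad :: "'a \<Rightarrow> 'a dual"
    and hess :: "'a \<Rightarrow> 'a \<Rightarrow> 'a dual"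
    and \<mu> L L2 \<eta>1 S Hc \<Omega> tbar \<Upsilon> :: real
    and xs :: 'a
    and x :: "nat \<Rightarrow> 'a"
    and H :: "nat \<Rightarrow> 'a dual \<Rightarrow> 'a"
    and i :: "nat \<Rightarrow> nat"
    and \<sigma> r :: "nat \<Rightarrow> real"
    and K0L :: nat and K1L :: int
  assumes B: "spd_op B"
    and params: "\<mu> > 0" "L > 0" "L2 \<ge> 0"
    and diff: "twice_differentiable_with f grad hess"
    and strongly_convex:
      "\<And>u v. \<langle>grad u - grad v, u - v\<rangle> \<ge> \<mu> * (primal_norm B (u - v))\<^sup>2"
    and lipschitz_grad:
      "\<And>u v. dual_norm B (grad u - grad v) \<le> L * primal_norm B (u - v)"
    and lipschitz_hess:
      "\<And>u v. operator_norm B (\<lambda>w. hess u w - hess v w) \<le> L2 * primal_norm B (u - v)"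
    and minimizer: "\<And>u. f xs \<le> f u"
    and Hc: "Hc = sqrt 2 * L2 / \<mu> powr (3 / 2)"
    and \<eta>1: "0 < \<eta>1" "\<eta>1 < 1 / 2"
    and bfgs: "bfgs_method grad x H (\<lambda>k. 1 / 2 ^ i k)"
    and line_search:
      "\<And>k. armijo f grad \<eta>1 (x k) (H k (grad (x k))) (i k)"
      "\<And>k j. armijo f grad \<eta>1 (x k) (H k (grad (x k))) j \<Longrightarrow> i k \<le> j"
    and curvature: "\<And>k. \<langle>grad (x (Suc k)) - grad (x k), x (Suc k) - x k\<rangle> > 0"
    and \<sigma>: "\<And>k. \<sigma> k = sqrt (f (x k) - f xs)"
    and r: "\<And>k. r k = sqrt \<langle>hess xs (x k - xs), x k - xs\<rangle>"
    and S: "\<And>k. k \<ge> 1 \<Longrightarrow> Hc * (\<Sum>j<k. \<sigma> j) \<le> S"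
    and \<Omega>: "\<Omega> = psi (hess xs) (inv (H 0)) + 2 * S"
    and K0L: "Hc * \<sigma> K0L \<le> 0.06 * (1 - 2 * \<eta>1)"
    and tbar: "tbar = 0.9 * ((1 - 2 * \<eta>1) / (2 * (1 - \<eta>1)))"
    and \<Upsilon>: "\<Upsilon> = inverse (omega_star tbar)"
    and K1L: "K1L = \<lceil>7 * (\<Upsilon> + 3.02) * \<Omega>\<rceil>"
  shows "\<forall>k::nat. int k \<ge> K1L \<longrightarrow> r (K0L + k) \<le> (1 / 2 ^ k) * r K0L"
proof -
  interpret smooth_convex_problem B f grad hess \<mu> L2 xs
    by unfold_locales (use B params diff strongly_convex lipschitz_hess minimizer in auto)
  define \<delta> where "\<delta> k = x (Suc k) - x k" for k
  define \<gamma> where "\<gamma> k = grad (x (Suc k)) - grad (x k)" for k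
  define d where "d k = H k (grad (x k))" for k
  define G where "G k = inv (H k)" for k
  define \<Delta> where "\<Delta> k = bfgs_decrease A (G k) (\<delta> k)" for k
  have H0: "spd_dual_op (H 0)"
    and x_Suc: "x (Suc k) = x k - (1 / 2 ^ i k) *\<^sub>R d k"
    and H_Suc: "H (Suc k) = bfgs_update (H k) (\<delta> k) (\<gamma> k)" for k
    using bfgs unfolding bfgs_method_def d_def \<delta>_def \<gamma>_def by blast+
  have curv: "\<langle>\<gamma> k, \<delta> k\<rangle> > 0" for k using curvature by (simp add: \<gamma>_def \<delta>_def)
  \<comment> \<open>Both facts are carried together: \<open>inv_bfgs_direct\<close> applies to an
    update written through \<open>inv (G k)\<close> with \<open>G k\<close> positive
    definite.\<close>
  have GH: "spd_op (G k) \<and> H k = inv (G k)" for k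
  proof (induction k)
    case 0
    show ?case using spd_dual_op_inv[OF H0] by (simp add: G_def inv_inv_eq)
  next
    case (Suc k)
    let ?G = "bfgs_direct (G k) (\<delta> k) (\<gamma> k)"
    have spd: "spd_op ?G" using Suc curv by (blast intro: spd_bfgs_direct)
    have "H (Suc k) = inv ?G" using Suc curv inv_bfgs_direct H_Suc by metis
    then show ?case using spd inv_inv_eq[OF bij_spd_op[OF spd]] by (simp add: G_def)
  qed
  then have G: "spd_op (G k)" and H_eq: "H k = inv (G k)" for k by auto
  have G_Suc: "G (Suc k) = bfgs_direct (G k) (\<delta> k) (\<gamma> k)" for k
  proof -
    have "H (Suc k) = inv (bfgs_direct (G k) (\<delta> k) (\<gamma> k))"
      using H_Suc H_eq inv_bfgs_direct[OF G curv] by simp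
    then show ?thesis
      using inv_inv_eq[OF bij_spd_op[OF spd_bfgs_direct[OF G curv]]] by (simp add: G_def)
  qed
  have Gd: "G k (d k) = grad (x k)" for k
    by (simp add: d_def H_eq spd_op_inv(1)[OF G])
  have \<delta>_d: "\<delta> k = (- (1 / 2 ^ i k)) *\<^sub>R d k" for k
    by (simp add: \<delta>_def x_Suc)
  have \<delta>_ne: "\<delta> k \<noteq> 0" for k using curv[of k] by auto
  then have d_ne: "d k \<noteq> 0" for k using \<delta>_d by (metis scaleR_zero_right)
  have \<Delta>_d: "\<Delta> k = bfgs_decrease A (G k) (d k)" for k
    unfolding \<Delta>_def \<delta>_d by (rule bfgs_decrease_scaleR[OF spd_hess G]) simp
  have \<Delta>_nonneg: "\<Delta> k \<ge> 0" for k
    unfolding \<Delta>_def by (rule bfgs_decrease_nonneg[OF spd_hess G \<delta>_ne])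
  have r_eq: "r k = nA (x k - xs)" for k by (simp add: r primal_norm_def)
  have r_nonneg: "r k \<ge> 0" for k unfolding r_eq by (rule nA_nonneg)
  have \<sigma>_nonneg: "\<sigma> k \<ge> 0" for k by (simp add: \<sigma> minimizer)
  have Hc_nonneg: "Hc \<ge> 0" using params by (simp add: Hc)

  have \<sigma>_Suc: "\<sigma> (Suc k) \<le> \<sigma> k" for k
  proof -
    have "0 \<le> \<langle>G k (d k), d k\<rangle>" by (rule spd_op_nonneg[OF G])
    then have "0 \<le> \<eta>1 * (1 / 2 ^ i k) * \<langle>grad (x k), d k\<rangle>" using \<eta>1 by (simp add: Gd)
    then have "f (x (Suc k)) \<le> f (x k)"
      using line_search(1)[of k] by (simp add: armijo_def x_Suc flip: d_def)
    then show ?thesis by (simp add: \<sigma>)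
  qed
  then have \<sigma>_anti: "\<sigma> n \<le> \<sigma> m" if "m \<le> n" for m n
    using decseq_SucI[of \<sigma>] that by (simp add: decseq_def)
  have rho_le: "rho (x k) \<le> Hc * \<sigma> k" for k
    using rho_le_residual[of "x k"] by (simp add: Hc \<sigma>)

  have potential: "psi A (G n) + (\<Sum>j<n. \<Delta> j) \<le> psi A (G 0) + 2 * (Hc * (\<Sum>j<n. \<sigma> j))" for n
  proof (induction n)
    case (Suc n)
    \<comment> \<open>Monotonicity of \<open>\<sigma>\<close> makes \<open>Hc * \<sigma> n\<close> a
      common bound for \<open>rho\<close> at both ends of the step.\<close>
    have "rho (x (Suc n)) \<le> Hc * \<sigma> n"
      using rho_le[of "Suc n"] mult_left_mono[OF \<sigma>_Suc[of n] Hc_nonneg] by linarith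
    then have "psi A (G (Suc n)) \<le> psi A (G n) - \<Delta> n + 2 * (Hc * \<sigma> n)"
      using psi_step[OF G rho_le, of "x (Suc n)" n n] curvature[of n]
      by (simp add: G_Suc \<Delta>_def \<delta>_def \<gamma>_def)
    then show ?case using Suc by (simp add: algebra_simps)
  qed simp
  have sum_\<Delta>: "(\<Sum>j<n. \<Delta> j) \<le> \<Omega>" if "n \<ge> 1" for n
    using potential[of n] S[OF that] psi_nonneg[OF spd_hess G, of xs n] by (simp add: \<Omega> G_def)

  have tbar_range: "0 < tbar" "tbar \<le> 0.45"
    using \<eta>1 by (simp_all add: tbar field_simps)
  note omega = omega_star_le[OF tbar_range]
  define D where "D = 1 / (\<Upsilon> + 3.02)"
  have \<Upsilon>_ge: "\<Upsilon> \<ge> 1 / 0.15"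
    unfolding \<Upsilon> inverse_eq_divide using omega by (intro divide_left_mono) auto
  then have D: "0 < D" "D \<le> 0.10325" "7 * (\<Upsilon> + 3.02) * \<Omega> = 7 * \<Omega> / D"
    by (auto simp: D_def field_simps)
  have D_omega: "D < omega_star tbar"
  proof -
    have "D < 1 / \<Upsilon>" unfolding D_def using \<Upsilon>_ge by (intro divide_strict_left_mono) auto
    then show ?thesis by (simp add: \<Upsilon> inverse_eq_divide)
  qed

  have small: "Hc * \<sigma> k \<le> 0.06 * (1 - 2 * \<eta>1)" "rho (x k) \<le> 0.06" if "k \<ge> K0L" for k
  proof -
    show 1: "Hc * \<sigma> k \<le> 0.06 * (1 - 2 * \<eta>1)"
      using mult_left_mono[OF \<sigma>_anti[OF that] Hc_nonneg] K0L by linarith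
    have "0.06 * (1 - 2 * \<eta>1) \<le> 0.06" using \<eta>1 by simp
    then show "rho (x k) \<le> 0.06" using 1 rho_le[of k] by linarith
  qed

  have contraction: "\<sigma> (Suc k) \<le> exp (- 0.85 * (1 - \<Delta> k / D)) * \<sigma> k" if k: "k \<ge> K0L" for k
  proof (cases "\<Delta> k < D")
    case False
    then have "1 \<le> \<Delta> k / D" using D(1) by simp
    then have "1 \<le> exp (- 0.85 * (1 - \<Delta> k / D))" by simp
    from mult_right_mono[OF this \<sigma>_nonneg[of k]] show ?thesis using \<sigma>_Suc[of k] by simp
  next
    case True
    have pos: "\<langle>G k (d k), d k\<rangle> > 0" "\<langle>A (d k), d k\<rangle> > 0"
      using spd_opD(3)[OF G d_ne] spd_opD(3)[OF spd_hess d_ne] .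
    define q where "q = \<langle>G k (d k), d k\<rangle> / \<langle>A (d k), d k\<rangle>"
    have q_pos: "q > 0" using pos by (simp add: q_def)
    have "q - 1 - ln q \<le> \<Delta> k"
      unfolding q_def \<Delta>_d by (rule bfgs_decrease_ge[OF spd_hess G d_ne])
    moreover have "omega_star tbar = (1 - tbar) - 1 - ln (1 - tbar)" by (simp add: omega_star_def)
    ultimately have "q - 1 - ln q < (1 - tbar) - 1 - ln (1 - tbar)" using True D_omega by linarith
    then have q: "q > 1 - tbar"
      using minus_ln_antimono[OF q_pos, of "1 - tbar"] tbar_range by linarith
    have "armijo f grad \<eta>1 (x k) (d k) 0"
    proof (rule armijo_full_step[OF \<eta>1])
      show "sqrt 2 * L2 / \<mu> powr (3 / 2) * sqrt (f (x k) - f xs) \<le> 0.06 * (1 - 2 * \<eta>1)"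
        using small(1)[OF k] by (simp only: Hc \<sigma>)
      have "(1 - tbar) * \<langle>A (d k), d k\<rangle> \<le> q * \<langle>A (d k), d k\<rangle>"
        using q pos by (intro mult_right_mono) auto
      then have "(1 - tbar) * \<langle>A (d k), d k\<rangle> \<le> \<langle>grad (x k), d k\<rangle>"
        using pos by (simp add: q_def Gd)
      then show "(1 - 0.9 * ((1 - 2 * \<eta>1) / (2 * (1 - \<eta>1)))) * \<langle>A (d k), d k\<rangle> \<le> \<langle>grad (x k), d k\<rangle>"
        by (simp only: tbar)
    qed (rule d_ne)
    \<comment> \<open>The line search takes the least accepted exponent, and 0 is accepted.\<close>
    then have "i k = 0" using line_search(2)[of k 0] by (simp add: d_def)
    then have step: "x (Suc k) = x k - d k" by (simp add: x_Suc)
    have "q \<ge> 0.55" using q tbar_range by simp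
    then have "r (Suc k) \<le> (rho (x k) / 2 + (1 + rho (x k) / 2) * sqrt (6 * \<Delta> k)) * r k"
      unfolding r_eq step \<Delta>_d by (intro full_step_contraction[OF G d_ne Gd]) (simp add: q_def)
    also have "\<dots> \<le> (0.03 + 1.03 * sqrt (6 * \<Delta> k)) * r k"
      using small(2)[OF k] \<Delta>_nonneg[of k]
      by (intro mult_right_mono add_mono r_nonneg) auto
    finally have r_Suc: "r (Suc k) \<le> (0.03 + 1.03 * sqrt (6 * \<Delta> k)) * r k" .
    have c: "0 \<le> 1.0205 * (0.03 + 1.03 * sqrt (6 * \<Delta> k))" using \<Delta>_nonneg[of k] by simp
    have "\<sigma> (Suc k) \<le> 1.0205 * (0.7 * r (Suc k))"
      using residual_norm_bounds(2)[OF small(2), of "Suc k"] k by (simp add: \<sigma> r_eq)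
    also have "\<dots> \<le> 1.0205 * (0.7 * ((0.03 + 1.03 * sqrt (6 * \<Delta> k)) * r k))"
      by (intro mult_left_mono r_Suc) auto
    also have "\<dots> = 1.0205 * (0.03 + 1.03 * sqrt (6 * \<Delta> k)) * (0.7 * r k)"
      by (simp only: mult_ac)
    also have "\<dots> \<le> 1.0205 * (0.03 + 1.03 * sqrt (6 * \<Delta> k)) * \<sigma> k"
      using residual_norm_bounds(1)[OF small(2), of k] k
      by (intro mult_left_mono c) (simp add: \<sigma> r_eq)
    also have "\<dots> \<le> exp (- 0.85 * (1 - \<Delta> k / D)) * \<sigma> k"
      using True \<Delta>_nonneg[of k] D
      by (intro mult_right_mono contraction_factor_le \<sigma>_nonneg) auto
    finally show ?thesis .
  qed
  have product: "\<sigma> (K0L + k) \<le> exp (- 0.85 * (k - (\<Sum>j<k. \<Delta> (K0L + j)) / D)) * \<sigma> K0L" for k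
  proof (induction k)
    case (Suc k)
    have "\<sigma> (Suc (K0L + k)) \<le> exp (- 0.85 * (1 - \<Delta> (K0L + k) / D)) * \<sigma> (K0L + k)"
      by (rule contraction) simp
    also have "\<dots> \<le> exp (- 0.85 * (1 - \<Delta> (K0L + k) / D))
        * (exp (- 0.85 * (k - (\<Sum>j<k. \<Delta> (K0L + j)) / D)) * \<sigma> K0L)"
      by (intro mult_left_mono Suc) simp
    also have "\<dots> = exp (- 0.85 * ((1 - \<Delta> (K0L + k) / D) + (k - (\<Sum>j<k. \<Delta> (K0L + j)) / D))) * \<sigma> K0L"
      by (simp only: distrib_left exp_add mult.assoc)
    also have "(1 - \<Delta> (K0L + k) / D) + (k - (\<Sum>j<k. \<Delta> (K0L + j)) / D)
        = Suc k - (\<Sum>j<Suc k. \<Delta> (K0L + j)) / D"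
      by (simp add: add_divide_distrib)
    finally show ?case by simp
  qed simp

  show ?thesis
  proof (intro allI impI)
    fix k :: nat assume k: "int k \<ge> K1L"
    show "r (K0L + k) \<le> (1 / 2 ^ k) * r K0L"
    \<comment> \<open>For \<open>k = 0\<close> the claim is trivial. For \<open>k \<ge> 1\<close> at
      least one spare factor \<open>exp 0.034\<close> is available, and it covers the loss
      1.0205.\<close>
    proof (cases "k = 0")
      case False
      have "(\<Sum>j<k. \<Delta> (K0L + j)) \<le> (\<Sum>j<K0L + k. \<Delta> j)"
      proof -
        have "(\<Sum>j<k. \<Delta> (K0L + j)) = (\<Sum>j\<in>{K0L..<K0L + k}. \<Delta> j)"
          by (rule sum.reindex_bij_witness[of _ "\<lambda>j. j - K0L" "\<lambda>j. K0L + j"]) auto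
        also have "\<dots> \<le> (\<Sum>j<K0L + k. \<Delta> j)" by (rule sum_mono2) (auto simp: \<Delta>_nonneg)
        finally show ?thesis .
      qed
      also have "\<dots> \<le> \<Omega>" by (rule sum_\<Delta>) (use False in simp)
      finally have "7 * ((\<Sum>j<k. \<Delta> (K0L + j)) / D) \<le> 7 * \<Omega> / D" using D by (simp add: divide_right_mono)
      also have "\<dots> \<le> k" using k unfolding K1L D(3) by linarith
      finally have "- 0.85 * (k - (\<Sum>j<k. \<Delta> (K0L + j)) / D) \<le> - (0.85 * 6 / 7) * k" by simp
      then have "exp (- 0.85 * (k - (\<Sum>j<k. \<Delta> (K0L + j)) / D)) \<le> exp (- (0.85 * 6 / 7) * k)"
        by (simp only: exp_le_cancel_iff)
      then have "\<sigma> (K0L + k) \<le> exp (- (0.85 * 6 / 7) * k) * \<sigma> K0L"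
        using product[of k] mult_right_mono[OF _ \<sigma>_nonneg[of K0L]] by (meson order_trans)
      also have "\<dots> \<le> exp (- (0.85 * 6 / 7) * k) * (1.0205 * (0.7 * r K0L))"
        using residual_norm_bounds(2)[OF small(2), of K0L] by (intro mult_left_mono) (auto simp: \<sigma> r_eq)
      also have "\<dots> = 0.7 * (1.0205 * exp (- (0.85 * 6 / 7) * k) * r K0L)" by (simp only: mult_ac)
      finally have "\<sigma> (K0L + k) \<le> 0.7 * (1.0205 * exp (- (0.85 * 6 / 7) * k) * r K0L)" .
      moreover have "0.7 * r (K0L + k) \<le> \<sigma> (K0L + k)"
        using residual_norm_bounds(1)[OF small(2), of "K0L + k"] by (simp add: \<sigma> r_eq)
      ultimately have 1: "r (K0L + k) \<le> 1.0205 * exp (- (0.85 * 6 / 7) * k) * r K0L" by simp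
      \<comment> \<open>0.034 is just below \<open>0.85 * 6 / 7 - 25 / 36\<close>, where 25/36 is an
        upper bound for \<open>ln 2\<close>.\<close>
      have "1.0205 \<le> 1 + 0.034 * real k" using False by simp
      also have "\<dots> \<le> exp (0.034 * k)" by (rule exp_ge_add_one_self)
      finally have "1.0205 \<le> exp (0.034 * k)" .
      then have "1.0205 * exp (- (0.85 * 6 / 7) * k) \<le> exp (0.034 * k) * exp (- (0.85 * 6 / 7) * k)"
        by (intro mult_right_mono) auto
      also have "\<dots> \<le> exp (- (k * ln 2))"
      proof -
        have "real k * ln 2 \<le> k * (25 / 36)" by (intro mult_left_mono ln2_le_25_over_36) auto
        then show ?thesis by (simp flip: exp_add)
      qed
      also have "\<dots> = 1 / 2 ^ k"
        by (simp add: exp_minus exp_of_nat_mult inverse_eq_divide)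
      finally have "1.0205 * exp (- (0.85 * 6 / 7) * k) \<le> 1 / 2 ^ k" .
      from 1 mult_right_mono[OF this r_nonneg[of K0L]] show ?thesis by linarith
    qed simp
  qed
qed

end
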